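(* Let $(S,\mathcal S)$ be a metric space with its Borel $\sigma$-field, let $X=(X_n,n\in\mathbb T)$ be a bifurcating Markov chain on $S$ with initial distribution $\nu$ and $\mathbb T$-transition probability $P$, and let $\Pi$ be a uniform generation-preserving random permutation independent of $X$. Assume that the induced Markov chain $(Y_r,r\in\mathbb N)$ is ergodic, with stationary distribution $\mu$. Then, for any bounded continuous $f:S\to\mathbb R$, the three empirical averages $\overline M_{\mathbb G_q}(f)$ (as $q\to\infty$), $\overline M_{\mathbb T_r}(f)$ (as $r\to\infty$) and $\overline M_n^{\Pi}(f)$ (as $n\to\infty$) converge to $(\mu,f)=\int_S f\,d\mu$ in $L^2$.
   Context: Tree. $\mathbb T=\mathbb N^*=\{1,2,\dots\}$ is the binary tree: vertex $n$ has two daughters $2n$ and $2n+1$, the root is $1$. $\mathbb G_q=\{2^q,\dots,2^{q+1}-1\}$ is the $q$th generation, $\mathbb T_r=\bigcup_{q=0}^r\mathbb G_q$, $r_n=\lfloor\log_2 n\rfloor$ is the generation of $n$. $\mathbb T$-transition probability. A map $P:S\times\mathcal S^2\to[0,1]$ ($\mathcal S^2$ the product $\sigma$-field on $S^2$) such that $P(\cdot,A)$ is measurable for all $A\in\mathcal S^2$ and $P(x,\cdot)$ is a probability on $(S^2,\mathcal S^2)$ for all $x\in S$. Put $P_0(x,B)=P(x,B\times S)$, $P_1(x,B)=P(x,S\times B)$, $Q=(P_0+P_1)/2$. For measurable $f:S^2\to\mathbb R$, $Pf(x)=\int_{S^2}f(y,z)P(x,dy\,dz)$ when defined. Bifurcating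 Markov chain. On a filtered probability space $(\Omega,\mathcal F,(\mathcal F_r)_{r\in\mathbb N},\mathbb P)$, a family $(X_n,n\in\mathbb T)$ of $S$-valued random variables is a bifurcating Markov chain with initial distribution $\nu$ and $\mathbb T$-transition probability $P$ if $X_n$ is $\mathcal F_{r_n}$-measurable for all $n$, $X_1$ has law $\nu$, and for all $q\in\mathbb N$ and all families $(f_n,n\in\mathbb G_q)$ of bounded measurable functions on $S^2$, $\mathbb E[\prod_{n\in\mathbb G_q}f_n(X_{2n},X_{2n+1})\mid\mathcal F_q]=\prod_{n\in\mathbb G_q}Pf_n(X_n)$. The default filtration is $\mathcal F_r=\sigma(X_i,i\in\mathbb T_r)$. Induced chain. $Y_0=X_1$, and if $Y_r=X_n$ then $Y_{r+1}=X_{2n+\zeta_{r+1}}$, where $(\zeta_q)_{q\ge1}$ are i.i.d. with $\mathbb P(\zeta_q=0)=\mathbb P(\zeta_q=1)=1/2$, independent of $(X,\Pi)$. $Y$ is a Markov chain with initial law $\nu$ and transition probability $Q$; $\mathbb E_x[f(Y_r)]=Q^rf(x)$ is the expectation when started from $x$. Ergodicity. $Y$ is ergodic if there is a probability $\mu$ on $(S,\mathcal S)$ such that $\lim_{r\to\infty}\mathbb E_x[f(Y_r)]=\int_S f\,d\mu$ for all $x\in S$ and all bounded continuous $f:S\to\mathbb R$. This $\mu$ is what is called the stationary distribution of $Y$. Random permutation. $\Pi$ is a random permutation of $\mathbb N^*$ leaving each $\mathbb G_q$ invariant, whose restrictions to the $\mathbb G_q$ are independent over $q$, each uniform among the $(2^q)!$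 permutations of $\mathbb G_q$. Averages. For measurable $f:S\to\mathbb R$ and finite $I\subset\mathbb T$: $\overline M_I(f)=|I|^{-1}\sum_{i\in I}f(X_i)$ and $\overline M_n^\Pi(f)=n^{-1}\sum_{i=1}^n f(X_{\Pi(i)})$. *)

theory Defs
  imports "HOL-Probability.Probability" "HOL-Combinatorics.Permutations"
begin

section \<open>The binary tree\<close>

text \<open>The vertices are the positive naturals; the value of a tree-indexed family at \<open>0\<close> is junk
  that no definition below refers to.\<close>

definition tree :: "nat set" where
  "tree = {1..}"

definition generation :: "nat \<Rightarrow> nat set" where
  "generation q = {2 ^ q ..< 2 ^ (q + 1)}"

definition subtree :: "nat \<Rightarrow> nat set" where
  "subtree r = (\<Union>q\<le>r. generation q)"

definition gen_of :: "nat \<Rightarrow> nat" where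
  "gen_of n = nat \<lfloor>log 2 (real n)\<rfloor>"


section \<open>Bifurcating Markov chains\<close>

text \<open>The state space \<open>S\<close> is a type \<open>'a\<close> of class \<open>metric_space\<close> with its Borel \<open>\<sigma>\<close>-field.
  It need not be separable, so \<open>borel \<Otimes>\<^sub>M borel\<close>, the product \<open>\<sigma>\<close>-field, may be smaller
  than the Borel \<open>\<sigma>\<close>-field of the product space.\<close>

definition T_transition :: "('a::metric_space \<Rightarrow> ('a \<times> 'a) measure) \<Rightarrow> bool" where
  "T_transition P \<longleftrightarrow>
     (\<forall>x. sets (P x) = sets (borel \<Otimes>\<^sub>M borel) \<and> prob_space (P x)) \<and>
     (\<forall>A \<in> sets (borel \<Otimes>\<^sub>M borel). (\<lambda>x. measure (P x) A) \<in> borel_measurable borel)"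

definition bifurcating_markov_chain ::
    "'w measure \<Rightarrow> (nat \<Rightarrow> 'w measure) \<Rightarrow> (nat \<Rightarrow> 'w \<Rightarrow> 'a::metric_space)
      \<Rightarrow> 'a measure \<Rightarrow> ('a \<Rightarrow> ('a \<times> 'a) measure) \<Rightarrow> bool" where
  "bifurcating_markov_chain M F X \<nu> P \<longleftrightarrow>
     prob_space M \<and>
     filtration (space M) F \<and> (\<forall>r. subalgebra M (F r)) \<and>
     T_transition P \<and>
     (\<forall>n \<in> tree. X n \<in> F (gen_of n) \<rightarrow>\<^sub>M borel) \<and>
     distr M borel (X 1) = \<nu> \<and>
     (\<forall>q. \<forall>f :: nat \<Rightarrow> 'a \<times> 'a \<Rightarrow> real.
        (\<forall>n \<in> generation q. f n \<in> borel_measurable (borel \<Otimes>\<^sub>M borel) \<and> bounded (range (f n))) \<longrightarrow>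
        (AE \<omega> in M.
           real_cond_exp M (F q) (\<lambda>\<omega>. \<Prod>n\<in>generation q. f n (X (2 * n) \<omega>, X (2 * n + 1) \<omega>)) \<omega>
           = (\<Prod>n\<in>generation q. \<integral>yz. f n yz \<partial>P (X n \<omega>))))"


section \<open>The induced Markov chain and its ergodicity\<close>

text \<open>\<open>Q = (P\<^sub>0 + P\<^sub>1) / 2\<close>, where \<open>P\<^sub>0\<close> and \<open>P\<^sub>1\<close> are the two marginals of \<open>P\<close>.\<close>

definition induced_kernel :: "('a::metric_space \<Rightarrow> ('a \<times> 'a) measure) \<Rightarrow> 'a \<Rightarrow> 'a measure" where
  "induced_kernel P x = measure_of UNIV (sets borel)
     (\<lambda>B. (emeasure (P x) (B \<times> UNIV) + emeasure (P x) (UNIV \<times> B)) / 2)"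

text \<open>The law of \<open>Y\<^sub>r\<close> for the Markov chain \<open>Y\<close> with transition probability \<open>Q\<close> started
  from \<open>x\<close>, that is, the iterated kernel \<open>Q\<^sup>r(x, \<cdot>)\<close>.\<close>

primrec induced_law ::
    "('a::metric_space \<Rightarrow> ('a \<times> 'a) measure) \<Rightarrow> nat \<Rightarrow> 'a \<Rightarrow> 'a measure" where
  "induced_law P 0 x = return borel x"
| "induced_law P (Suc r) x = induced_law P r x \<bind> induced_kernel P"

definition induced_chain_ergodic ::
    "('a::metric_space \<Rightarrow> ('a \<times> 'a) measure) \<Rightarrow> 'a measure \<Rightarrow> bool" where
  "induced_chain_ergodic P \<mu> \<longleftrightarrow>
     sets \<mu> = sets borel \<and> prob_space \<mu> \<and>
     (\<forall>x. \<forall>f :: 'a \<Rightarrow> real. continuous_on UNIV f \<longrightarrow> bounded (range f) \<longrightarrow>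
        (\<lambda>r. \<integral>y. f y \<partial>induced_law P r x) \<longlonglongrightarrow> (\<integral>y. f y \<partial>\<mu>))"

lemma T_transition_iff_kernel:
  "T_transition P \<longleftrightarrow> P \<in> borel \<rightarrow>\<^sub>M prob_algebra (borel \<Otimes>\<^sub>M borel)"
proof
  assume T: "T_transition P"
  show "P \<in> borel \<rightarrow>\<^sub>M prob_algebra (borel \<Otimes>\<^sub>M borel)"
  proof (rule measurable_prob_algebraI)
    show "prob_space (P x)" for x
      using T by (simp add: T_transition_def)
    show "P \<in> borel \<rightarrow>\<^sub>M subprob_algebra (borel \<Otimes>\<^sub>M borel)"
    proof (rule measurable_subprob_algebra)
      fix x show "subprob_space (P x)"
        using T by (simp add: T_transition_def prob_space_imp_subprob_space)
      show "sets (P x) = sets (borel \<Otimes>\<^sub>M borel)"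
        using T by (simp add: T_transition_def)
    next
      fix A :: "('a \<times> 'a) set" assume "A \<in> sets (borel \<Otimes>\<^sub>M borel)"
      then have "(\<lambda>x. ennreal (measure (P x) A)) \<in> borel_measurable borel"
        using T by (auto simp: T_transition_def)
      moreover have "emeasure (P x) A = ennreal (measure (P x) A)" for x
        using T by (intro finite_measure.emeasure_eq_measure prob_space.finite_measure)
          (simp add: T_transition_def)
      ultimately show "(\<lambda>x. emeasure (P x) A) \<in> borel_measurable borel"
        by simp
    qed
  qed
next
  assume P: "P \<in> borel \<rightarrow>\<^sub>M prob_algebra (borel \<Otimes>\<^sub>M borel)"
  have "P x \<in> space (prob_algebra (borel \<Otimes>\<^sub>M borel))" for x
    using measurable_space[OF P] by simp
  moreover have "(\<lambda>x. measure (P x) A) \<in> borel_measurable borel"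
    if "A \<in> sets (borel \<Otimes>\<^sub>M borel)" for A
    using measurable_compose[OF P measurable_measure_prob_algebra[OF that]] .
  ultimately show "T_transition P"
    by (auto simp: T_transition_def space_prob_algebra)
qed

lemma space_induced_kernel [simp]: "space (induced_kernel P x) = UNIV"
  by (simp add: induced_kernel_def)

lemma sets_induced_kernel [simp, measurable_cong]: "sets (induced_kernel P x) = sets borel"
  unfolding induced_kernel_def
  using sets.sets_measure_of_eq[of borel] by simp

lemma emeasure_induced_kernel:
  assumes P: "T_transition P" and B: "B \<in> sets borel"
  shows "emeasure (induced_kernel P x) B =
    (emeasure (P x) (B \<times> UNIV) + emeasure (P x) (UNIV \<times> B)) / 2"
proof -
  have sets_P [measurable_cong]: "sets (P x) = sets (borel \<Otimes>\<^sub>M borel)"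
    using P by (simp add: T_transition_def)
  then have sp: "space (P x) = UNIV"
    by (simp add: sets_eq_imp_space_eq space_pair_measure)
  have 1: "emeasure (P x) (B \<times> UNIV) = emeasure (distr (P x) borel fst) B" if "B \<in> sets borel" for B
    using that by (subst emeasure_distr) (auto simp: sp intro!: arg_cong[where f="emeasure (P x)"])
  have 2: "emeasure (P x) (UNIV \<times> B) = emeasure (distr (P x) borel snd) B" if "B \<in> sets borel" for B
    using that by (subst emeasure_distr) (auto simp: sp intro!: arg_cong[where f="emeasure (P x)"])
  show ?thesis
  proof (rule emeasure_measure_of[OF induced_kernel_def])
    show "countably_additive (sets (induced_kernel P x))
      (\<lambda>B. (emeasure (P x) (B \<times> UNIV) + emeasure (P x) (UNIV \<times> B)) / 2)"
    proof (rule countably_additiveI)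
      fix A :: "nat \<Rightarrow> 'a set"
      assume A: "range A \<subseteq> sets (induced_kernel P x)" "disjoint_family A"
        and U: "(\<Union>i. A i) \<in> sets (induced_kernel P x)"
      then have Ai: "A i \<in> sets borel" for i by auto
      have "(\<Sum>i. (emeasure (P x) (A i \<times> UNIV) + emeasure (P x) (UNIV \<times> A i)) / 2)
          = ((\<Sum>i. emeasure (distr (P x) borel fst) (A i))
              + (\<Sum>i. emeasure (distr (P x) borel snd) (A i))) / 2"
        unfolding 1[OF Ai] 2[OF Ai] divide_ennreal_def ennreal_suminf_multc
        by (subst suminf_add) (rule summableI refl)+
      also have "\<dots> = (emeasure (distr (P x) borel fst) (\<Union>i. A i)
              + emeasure (distr (P x) borel snd) (\<Union>i. A i)) / 2"
        using A by (intro arg_cong2[where f="(/)"] arg_cong2[where f="(+)"] suminf_emeasure refl) auto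
      finally show "(\<Sum>i. (emeasure (P x) (A i \<times> UNIV) + emeasure (P x) (UNIV \<times> A i)) / 2)
          = (emeasure (P x) ((\<Union>i. A i) \<times> UNIV) + emeasure (P x) (UNIV \<times> (\<Union>i. A i))) / 2"
        using U unfolding sets_induced_kernel by (simp only: 1 2)
    qed
  qed (use B in \<open>auto simp: positive_def\<close>)
qed

lemma induced_kernel_kernel:
  assumes P: "T_transition P"
  shows "induced_kernel P \<in> borel \<rightarrow>\<^sub>M prob_algebra borel"
proof -
  have K: "P \<in> borel \<rightarrow>\<^sub>M subprob_algebra (borel \<Otimes>\<^sub>M borel)"
    using P by (simp add: T_transition_iff_kernel measurable_prob_algebraD)
  have prob: "prob_space (induced_kernel P x)" for x
  proof
    have "prob_space (P x)" "space (P x) = UNIV"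
      using P sets_eq_imp_space_eq[of "P x" "borel \<Otimes>\<^sub>M borel"]
      by (auto simp: T_transition_def space_pair_measure)
    then have "emeasure (P x) UNIV = 1"
      using prob_space.emeasure_space_1[of "P x"] by simp
    then show "emeasure (induced_kernel P x) (space (induced_kernel P x)) = 1"
      by (simp add: emeasure_induced_kernel[OF P] ennreal_divide_self)
  qed
  show ?thesis
  proof (rule measurable_prob_algebraI[OF prob], rule measurable_subprob_algebra)
    fix B :: "'a set" assume B: "B \<in> sets borel"
    have "B \<times> UNIV \<in> sets (borel \<Otimes>\<^sub>M borel)" "UNIV \<times> B \<in> sets (borel \<Otimes>\<^sub>M borel)"
      using B by auto
    then have [measurable]: "(\<lambda>x. emeasure (P x) (B \<times> UNIV)) \<in> borel_measurable borel"
        "(\<lambda>x. emeasure (P x) (UNIV \<times> B)) \<in> borel_measurable borel"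
      by (auto intro: measurable_compose[OF K measurable_emeasure_subprob_algebra])
    show "(\<lambda>x. emeasure (induced_kernel P x) B) \<in> borel_measurable borel"
      unfolding emeasure_induced_kernel[OF P B] by measurable
  qed (auto intro: prob prob_space_imp_subprob_space)
qed


section \<open>Uniform generation-preserving random permutations\<close>

text \<open>\<open>restrict_id (\<pi> \<omega>) (generation q)\<close> is the restriction of \<open>\<pi> \<omega>\<close> to a generation, extended by
  the identity, so that it is an element of the finite set of permutations of that generation.\<close>

definition uniform_generation_permutation :: "'w measure \<Rightarrow> ('w \<Rightarrow> nat \<Rightarrow> nat) \<Rightarrow> bool" where
  "uniform_generation_permutation M \<pi> \<longleftrightarrow>
     (\<forall>\<omega> \<in> space M. bij_betw (\<pi> \<omega>) tree tree \<and> (\<forall>q. \<pi> \<omega> ` generation q = generation q)) \<and>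
     prob_space.indep_vars M (\<lambda>q. count_space {p. p permutes generation q})
       (\<lambda>q \<omega>. restrict_id (\<pi> \<omega>) (generation q)) UNIV \<and>
     (\<forall>q. distr M (count_space {p. p permutes generation q})
            (\<lambda>\<omega>. restrict_id (\<pi> \<omega>) (generation q))
          = uniform_count_measure {p. p permutes generation q})"

text \<open>The library's \<open>indep_var\<close> only covers random variables with values in the same type, so
  independence is expressed through the generated \<open>\<sigma>\<close>-fields \<open>\<sigma>(\<pi>)\<close> and \<open>\<sigma>(X)\<close>.\<close>

definition indep_of_chain ::
    "'w measure \<Rightarrow> ('w \<Rightarrow> nat \<Rightarrow> nat) \<Rightarrow> (nat \<Rightarrow> 'w \<Rightarrow> 'a::metric_space) \<Rightarrow> bool" where
  "indep_of_chain M \<pi> X \<longleftrightarrow>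
     prob_space.indep_set M
       (sets (vimage_algebra (space M) (\<lambda>\<omega>. \<lambda>n\<in>tree. \<pi> \<omega> n) (\<Pi>\<^sub>M n\<in>tree. count_space UNIV)))
       (sets (vimage_algebra (space M) (\<lambda>\<omega>. \<lambda>n\<in>tree. X n \<omega>) (\<Pi>\<^sub>M n\<in>tree. borel)))"


section \<open>Empirical averages and convergence in \<open>L\<^sup>2\<close>\<close>

definition avg :: "(nat \<Rightarrow> 'w \<Rightarrow> 'a) \<Rightarrow> nat set \<Rightarrow> ('a \<Rightarrow> real) \<Rightarrow> 'w \<Rightarrow> real" where
  "avg X I f \<omega> = (\<Sum>i\<in>I. f (X i \<omega>)) / real (card I)"

definition avg_perm ::
    "(nat \<Rightarrow> 'w \<Rightarrow> 'a) \<Rightarrow> ('w \<Rightarrow> nat \<Rightarrow> nat) \<Rightarrow> nat \<Rightarrow> ('a \<Rightarrow> real) \<Rightarrow> 'w \<Rightarrow> real" where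
  "avg_perm X \<pi> n f \<omega> = (\<Sum>i=1..n. f (X (\<pi> \<omega> i) \<omega>)) / real n"

definition L2 :: "'w measure \<Rightarrow> ('w \<Rightarrow> real) set" where
  "L2 M = {Z. Z \<in> borel_measurable M \<and> integrable M (\<lambda>\<omega>. (Z \<omega>)\<^sup>2)}"

definition tendsto_L2 :: "'w measure \<Rightarrow> (nat \<Rightarrow> 'w \<Rightarrow> real) \<Rightarrow> ('w \<Rightarrow> real) \<Rightarrow> bool" where
  "tendsto_L2 M Z Z' \<longleftrightarrow>
     (\<forall>n. Z n \<in> L2 M) \<and> Z' \<in> L2 M \<and> (\<lambda>n. \<integral>\<omega>. (Z n \<omega> - Z' \<omega>)\<^sup>2 \<partial>M) \<longlonglongrightarrow> 0"

end

theory Submission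
  imports Defs
begin

text \<open>Replace \<open>f\<close> by \<open>h = f - (\<mu>, f)\<close> and write \<open>a\<^sub>q(h)\<close> for the second moment of the average of
  \<open>h\<close> over generation \<open>q\<close>. Conditionally on generation \<open>q\<close>, distinct mothers have independent
  pairs of daughters, so \<open>a\<^sub>q\<^sub>+\<^sub>1(h) \<le> a\<^sub>q(Qh) + C\<^sup>2 / 2\<^sup>q\<close> with \<open>C\<close> a bound of \<open>h\<close>; hence
  \<open>a\<^sub>p\<^sub>+\<^sub>k(h) \<le> a\<^sub>p(Q\<^sup>kh) + 2C\<^sup>2 / 2\<^sup>p\<close>. Let \<open>k \<rightarrow> \<infinity>\<close> by dominated convergence, then
  \<open>p \<rightarrow> \<infinity>\<close>. The subtree average is a convex combination of the averages over its last generation and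
  over the rest, with weight at most one half on the rest. For the permuted average, sampling without
  replacement from the last, incomplete generation \<open>r\<close> costs only \<open>C\<^sup>2 / n\<close> beyond \<open>a\<^sub>r(h)\<close>.\<close>

section \<open>Generations\<close>

lemma finite_generation [simp]: "finite (generation q)"
  by (simp add: generation_def)

lemma card_generation [simp]: "card (generation q) = 2 ^ q"
  by (simp add: generation_def)

lemma generation_subset_tree: "generation q \<subseteq> tree"
proof
  fix n assume "n \<in> generation q"
  moreover have "(1::nat) \<le> 2 ^ q" by simp
  ultimately show "n \<in> tree"
    unfolding generation_def tree_def by (simp only: atLeastLessThan_iff atLeast_iff) linarith
qed

lemma generation_Suc: "generation (Suc q) = (\<lambda>n. 2 * n) ` generation q \<union> (\<lambda>n. 2 * n + 1) ` generation q"
proof (intro equalityI subsetI)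
  fix k assume k: "k \<in> generation (Suc q)"
  then have "k div 2 \<in> generation q"
    by (auto simp: generation_def)
  moreover have "k = 2 * (k div 2) \<or> k = 2 * (k div 2) + 1"
    by presburger
  ultimately show "k \<in> (\<lambda>n. 2 * n) ` generation q \<union> (\<lambda>n. 2 * n + 1) ` generation q"
    by blast
qed (auto simp: generation_def)

lemma sum_generation_Suc:
  fixes g :: "nat \<Rightarrow> real"
  shows "(\<Sum>k\<in>generation (Suc q). g k) = (\<Sum>n\<in>generation q. g (2 * n) + g (2 * n + 1))"
proof -
  have disj: "(\<lambda>n. 2 * n) ` generation q \<inter> (\<lambda>n. 2 * n + 1) ` generation q = {}"
    by auto presburger
  have "(\<Sum>k\<in>generation (Suc q). g k)
      = (\<Sum>k\<in>(\<lambda>n. 2 * n) ` generation q. g k) + (\<Sum>k\<in>(\<lambda>n. 2 * n + 1) ` generation q. g k)"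
    unfolding generation_Suc by (rule sum.union_disjoint) (use disj in auto)
  also have "\<dots> = (\<Sum>n\<in>generation q. g (2 * n)) + (\<Sum>n\<in>generation q. g (2 * n + 1))"
    by (subst (1 2) sum.reindex) (auto simp: inj_on_def)
  finally show ?thesis by (simp add: sum.distrib)
qed

section \<open>Integrals against the induced chain\<close>

text \<open>The kernel Q is a fair-coin mixture of the two marginals of \<open>P x\<close>.
  Rewriting \<open>induced_kernel P x\<close> as a bind over a Bernoulli law turns its integral into
  an iterated integral, which the set-function definition does not give directly.\<close>

lemma integral_induced_kernel:
  fixes h :: "'a::metric_space \<Rightarrow> real"
  assumes P: "T_transition P" and h: "h \<in> borel_measurable borel" and C: "\<And>y. \<bar>h y\<bar> \<le> C"
  shows "(\<integral>y. h y \<partial>induced_kernel P x) = (\<integral>yz. h (fst yz) + h (snd yz) \<partial>P x) / 2"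
proof -
  have sets_P [measurable_cong]: "sets (P x) = sets (borel \<Otimes>\<^sub>M borel)"
    using P by (simp add: T_transition_def)
  interpret P: prob_space "P x"
    using P by (simp add: T_transition_def)
  have sp: "space (P x) = UNIV"
    using sets_eq_imp_space_eq[OF sets_P] by (simp add: space_pair_measure)
  \<comment> \<open>The coin \<open>b\<close> selects which of the two daughters is followed, as
    \<zeta> does for the chain Y.\<close>
  define coord :: "bool \<Rightarrow> 'a \<times> 'a \<Rightarrow> 'a" where "coord b = (if b then fst else snd)" for b
  have coord [measurable]: "coord b \<in> P x \<rightarrow>\<^sub>M borel" for b
    by (cases b) (auto simp: coord_def)
  define N where "N = measure_pmf (bernoulli_pmf (1 / 2)) \<bind> (\<lambda>b. distr (P x) borel (coord b))"
  have K: "(\<lambda>b. distr (P x) borel (coord b))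
      \<in> measure_pmf (bernoulli_pmf (1 / 2)) \<rightarrow>\<^sub>M subprob_algebra borel"
    by (auto simp: space_subprob_algebra intro!: prob_space_imp_subprob_space P.prob_space_distr)
  have "induced_kernel P x = N"
  proof (rule measure_eqI)
    show sets_N: "sets (induced_kernel P x) = sets N"
      unfolding N_def by (subst sets_bind[where N=borel]) auto
    fix B assume "B \<in> sets (induced_kernel P x)"
    then have B: "B \<in> sets borel" by simp
    have "emeasure N B = (\<integral>\<^sup>+b. emeasure (distr (P x) borel (coord b)) B \<partial>bernoulli_pmf (1 / 2))"
      unfolding N_def by (rule emeasure_bind[OF _ K B]) simp
    also have "\<dots> = (emeasure (P x) (B \<times> UNIV) + emeasure (P x) (UNIV \<times> B)) / 2"
    proof -
      have "emeasure (distr (P x) borel fst) B = emeasure (P x) (B \<times> UNIV)"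
           "emeasure (distr (P x) borel snd) B = emeasure (P x) (UNIV \<times> B)"
        using B by (subst emeasure_distr; auto simp: sp intro!: arg_cong[where f="emeasure (P x)"])+
      moreover have "ennreal (1/2) = 1 / 2"
        by (metis divide_ennreal ennreal_1 ennreal_numeral zero_le_numeral zero_le_one zero_less_numeral)
      ultimately show ?thesis
        by (simp add: coord_def nn_integral_measure_pmf_finite[of "bernoulli_pmf (1/2)"]
            UNIV_bool divide_ennreal_def distrib_right)
    qed
    finally show "emeasure (induced_kernel P x) B = emeasure N B"
      by (simp add: emeasure_induced_kernel[OF P B])
  qed
  moreover have "integral\<^sup>L N h
      = (\<integral>b. integral\<^sup>L (distr (P x) borel (coord b)) h \<partial>bernoulli_pmf (1 / 2))"
    unfolding N_def using C prob_space.emeasure_space_1[OF P.prob_space_distr[OF coord]]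
    by (intro integral_bind[where B=C and B'=1 and K=borel] K h) auto
  moreover have "integral\<^sup>L (distr (P x) borel fst) h = (\<integral>yz. h (fst yz) \<partial>P x)"
      "integral\<^sup>L (distr (P x) borel snd) h = (\<integral>yz. h (snd yz) \<partial>P x)"
    using integral_distr[OF coord h, of True] integral_distr[OF coord h, of False]
    by (simp_all add: coord_def)
  moreover have "integrable (P x) (\<lambda>yz. h (coord b yz))" for b
    by (rule P.integrable_const_bound[of _ C]) (use C in \<open>auto intro: measurable_compose[OF coord h]\<close>)
  from this[of True] this[of False]
  have "(\<integral>yz. h (fst yz) + h (snd yz) \<partial>P x) = (\<integral>yz. h (fst yz) \<partial>P x) + (\<integral>yz. h (snd yz) \<partial>P x)"
    by (intro Bochner_Integration.integral_add) (auto simp: coord_def)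
  ultimately show ?thesis by (simp add: coord_def)
qed

text \<open>Averaging against a probability kernel cannot increase a uniform bound. Since Qh
  satisfies the hypotheses on h with the same \<open>C\<close>, the kernel can be applied repeatedly
  without the error constants growing.\<close>

lemma
  fixes h :: "'a::metric_space \<Rightarrow> real"
  assumes P: "T_transition P" and h: "h \<in> borel_measurable borel" and C: "\<And>y. \<bar>h y\<bar> \<le> C"
  shows measurable_integral_induced_kernel: "(\<lambda>x. \<integral>y. h y \<partial>induced_kernel P x) \<in> borel_measurable borel"
    and abs_integral_induced_kernel_le: "\<bar>\<integral>y. h y \<partial>induced_kernel P x\<bar> \<le> C"
proof -
  have K: "induced_kernel P \<in> borel \<rightarrow>\<^sub>M subprob_algebra borel"
    using induced_kernel_kernel[OF P] by (rule measurable_prob_algebraD)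
  show "(\<lambda>x. \<integral>y. h y \<partial>induced_kernel P x) \<in> borel_measurable borel"
    by (rule measurable_compose[OF K integral_measurable_subprob_algebra[OF h]])
  interpret prob_space "induced_kernel P x"
    using measurable_space[OF induced_kernel_kernel[OF P], of x] by (simp add: space_prob_algebra)
  have "integrable (induced_kernel P x) h"
    by (rule integrable_const_bound[of _ C]) (use C h in \<open>auto cong: measurable_cong_sets\<close>)
  have "\<bar>\<integral>y. h y \<partial>induced_kernel P x\<bar> \<le> (\<integral>y. \<bar>h y\<bar> \<partial>induced_kernel P x)"
     by (rule integral_abs_bound)
  also have "\<dots> \<le> (\<integral>y. C \<partial>induced_kernel P x)"
    by (rule integral_mono) (use C \<open>integrable _ h\<close> in auto)
  finally show "\<bar>\<integral>y. h y \<partial>induced_kernel P x\<bar> \<le> C"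
    by (simp add: prob_space[unfolded space_induced_kernel])
qed

lemma induced_law_prob_algebra:
  assumes P: "T_transition P"
  shows "induced_law P r x \<in> space (prob_algebra borel)"
proof (induction r)
  case 0
  show ?case by (simp add: space_prob_algebra prob_space_return)
next
  case (Suc r)
  then show ?case
    using prob_space_bind'[OF Suc induced_kernel_kernel[OF P]]
      sets_bind'[OF Suc induced_kernel_kernel[OF P]] by (simp add: space_prob_algebra)
qed

text \<open>Since \<open>induced_law\<close> appends the new step at the end, integrating out that
  step first turns h into Qh. This is the order in which the tree is peeled, from the youngest
  generation upwards.\<close>

lemma integral_induced_law_Suc:
  fixes h :: "'a::metric_space \<Rightarrow> real"
  assumes P: "T_transition P" and h: "h \<in> borel_measurable borel" and C: "\<And>y. \<bar>h y\<bar> \<le> C"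
  shows "(\<integral>y. h y \<partial>induced_law P (Suc r) x) = (\<integral>z. (\<integral>y. h y \<partial>induced_kernel P z) \<partial>induced_law P r x)"
proof -
  have *: "sets (induced_law P r x) = sets borel" "prob_space (induced_law P r x)"
    using induced_law_prob_algebra[OF P, of r x] by (auto simp: space_prob_algebra)
  then interpret prob_space "induced_law P r x" by simp
  have "induced_kernel P \<in> borel \<rightarrow>\<^sub>M subprob_algebra borel"
    using induced_kernel_kernel[OF P] by (rule measurable_prob_algebraD)
  then have K: "induced_kernel P \<in> induced_law P r x \<rightarrow>\<^sub>M subprob_algebra borel"
    using * by (simp cong: measurable_cong_sets)
  have "emeasure (induced_kernel P y) (space (induced_kernel P y)) = 1" for y
    using measurable_space[OF induced_kernel_kernel[OF P], of y]
    by (auto simp: space_prob_algebra dest: prob_space.emeasure_space_1)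
  then show ?thesis
    unfolding induced_law.simps
    by (intro integral_bind[where B=C and B'=1 and K=borel] K h) (use C in auto)
qed

section \<open>Second moments over a generation\<close>

lemma measurable_bifurcating_markov_chain:
  assumes "bifurcating_markov_chain M F X \<nu> P" "n \<in> tree"
  shows "X n \<in> M \<rightarrow>\<^sub>M borel"
  using assms measurable_from_subalg unfolding bifurcating_markov_chain_def by blast

text \<open>The branching property is applied to the family equal to \<open>u\<close> at
  \<open>i\<close> and \<open>j\<close> and to the constant 1 at the other vertices of the
  generation; taking expectations then removes the conditioning.\<close>

lemma bifurcating_markov_chain_pair:
  fixes X :: "nat \<Rightarrow> 'w \<Rightarrow> 'a::metric_space" and u :: "'a \<times> 'a \<Rightarrow> real"
  assumes X: "bifurcating_markov_chain M F X \<nu> P"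
    and ij: "i \<in> generation q" "j \<in> generation q" "i \<noteq> j"
    and u: "u \<in> borel_measurable (borel \<Otimes>\<^sub>M borel)" and K: "\<And>yz. \<bar>u yz\<bar> \<le> K"
  shows "(\<integral>\<omega>. u (X (2 * i) \<omega>, X (2 * i + 1) \<omega>) * u (X (2 * j) \<omega>, X (2 * j + 1) \<omega>) \<partial>M)
    = (\<integral>\<omega>. (\<integral>yz. u yz \<partial>P (X i \<omega>)) * (\<integral>yz. u yz \<partial>P (X j \<omega>)) \<partial>M)"
proof -
  interpret prob_space M using X by (simp add: bifurcating_markov_chain_def)
  interpret finite_measure_subalgebra M "F q"
    by unfold_locales (use X in \<open>simp add: bifurcating_markov_chain_def\<close>)
  define v where "v n = (if n \<in> {i, j} then u else (\<lambda>_. 1))" for n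
  \<comment> \<open>Stated for an abstract \<open>g\<close> because the product collapses twice:
    once for values at the daughters, once for integrals against P. The condition on
    \<open>g\<close> makes the constant factors equal to 1.\<close>
  have prod_v: "(\<Prod>n\<in>generation q. g n (v n)) = g i u * g j u"
    if "\<And>n. g n (\<lambda>_. 1) = 1" for g :: "nat \<Rightarrow> ('a \<times> 'a \<Rightarrow> real) \<Rightarrow> real"
  proof -
    have "(\<Prod>n\<in>generation q. g n (v n)) = (\<Prod>n\<in>{i, j}. g n (v n))"
      by (rule prod.mono_neutral_right) (use ij that in \<open>auto simp: v_def\<close>)
    then show ?thesis using ij by (simp add: v_def)
  qed
  have "v n \<in> borel_measurable (borel \<Otimes>\<^sub>M borel) \<and> bounded (range (v n))" for n
    using u K by (auto simp: v_def bounded_iff)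
  with X have "AE \<omega> in M.
      real_cond_exp M (F q) (\<lambda>\<omega>. \<Prod>n\<in>generation q. v n (X (2 * n) \<omega>, X (2 * n + 1) \<omega>)) \<omega>
      = (\<Prod>n\<in>generation q. \<integral>yz. v n yz \<partial>P (X n \<omega>))"
    unfolding bifurcating_markov_chain_def by blast
  moreover have "prob_space (P x)" for x
    using X by (simp add: bifurcating_markov_chain_def T_transition_def)
  then have "(\<integral>yz. 1 \<partial>P x) = (1::real)" for x
    using prob_space.prob_space[of "P x"] by simp
  ultimately have AE: "AE \<omega> in M.
      real_cond_exp M (F q) (\<lambda>\<omega>. u (X (2 * i) \<omega>, X (2 * i + 1) \<omega>) * u (X (2 * j) \<omega>, X (2 * j + 1) \<omega>)) \<omega>
      = (\<integral>yz. u yz \<partial>P (X i \<omega>)) * (\<integral>yz. u yz \<partial>P (X j \<omega>))"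
    using prod_v[of "\<lambda>n w. w (X (2 * n) _, X (2 * n + 1) _)"] prod_v[of "\<lambda>n w. \<integral>yz. w yz \<partial>P (X n _)"]
    by simp
  have "2 * n \<in> tree" "2 * n + 1 \<in> tree" if "n \<in> generation q" for n
    using that generation_subset_tree[of q] by (auto simp: tree_def)
  then have [measurable]: "X (2 * n) \<in> M \<rightarrow>\<^sub>M borel" "X (2 * n + 1) \<in> M \<rightarrow>\<^sub>M borel"
    if "n \<in> generation q" for n
    using that X measurable_bifurcating_markov_chain by blast+
  note [measurable] = u ij
  have m: "(\<lambda>\<omega>. u (X (2 * n) \<omega>, X (2 * n + 1) \<omega>)) \<in> borel_measurable M"
    if [measurable]: "n \<in> generation q" for n
    by measurable
  have "integrable M (\<lambda>\<omega>. u (X (2 * i) \<omega>, X (2 * i + 1) \<omega>) * u (X (2 * j) \<omega>, X (2 * j + 1) \<omega>))"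
    by (rule integrable_const_bound[of _ "K * K"])
       (use m ij K in \<open>auto simp: abs_mult intro!: mult_mono order_trans[OF abs_ge_zero K]\<close>)
  note real_cond_exp_int[OF this]
  moreover have "(\<integral>\<omega>. real_cond_exp M (F q)
      (\<lambda>\<omega>. u (X (2 * i) \<omega>, X (2 * i + 1) \<omega>) * u (X (2 * j) \<omega>, X (2 * j + 1) \<omega>)) \<omega> \<partial>M)
     = (\<integral>\<omega>. (\<integral>yz. u yz \<partial>P (X i \<omega>)) * (\<integral>yz. u yz \<partial>P (X j \<omega>)) \<partial>M)"
  proof (rule integral_cong_AE[OF _ _ AE])
    have "P \<in> borel \<rightarrow>\<^sub>M subprob_algebra (borel \<Otimes>\<^sub>M borel)"
      using X by (simp add: bifurcating_markov_chain_def T_transition_iff_kernel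
          measurable_prob_algebraD)
    then have "(\<lambda>x. \<integral>yz. u yz \<partial>P x) \<in> borel_measurable borel"
      by (rule measurable_compose[OF _ integral_measurable_subprob_algebra[OF u]])
    moreover have "X i \<in> M \<rightarrow>\<^sub>M borel" "X j \<in> M \<rightarrow>\<^sub>M borel"
      using X ij measurable_bifurcating_markov_chain generation_subset_tree by blast+
    ultimately show "(\<lambda>\<omega>. (\<integral>yz. u yz \<partial>P (X i \<omega>)) * (\<integral>yz. u yz \<partial>P (X j \<omega>))) \<in> borel_measurable M"
      by (intro borel_measurable_times measurable_compose[of "X _" M borel "\<lambda>x. \<integral>yz. u yz \<partial>P x"])
  qed simp
  ultimately show ?thesis by simp
qed

lemma measurable_avg:
  assumes "\<And>i. i \<in> I \<Longrightarrow> X i \<in> M \<rightarrow>\<^sub>M borel" "h \<in> borel_measurable borel"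
  shows "avg X I h \<in> borel_measurable M"
  unfolding avg_def[abs_def] using assms
  by (intro borel_measurable_divide borel_measurable_sum measurable_compose[of "X _" M borel h]) auto

lemma abs_avg_le:
  assumes "\<And>x. \<bar>h x\<bar> \<le> C"
  shows "\<bar>avg X I h \<omega>\<bar> \<le> C"
proof (cases "finite I \<and> I \<noteq> {}")
  case True
  have "\<bar>\<Sum>i\<in>I. h (X i \<omega>)\<bar> \<le> real (card I) * C"
    by (rule order_trans[OF sum_abs sum_bounded_above]) (rule assms)
  then show ?thesis using True by (simp add: avg_def field_simps card_gt_0_iff)
next
  \<comment> \<open>Here \<open>card I = 0\<close>, so division by zero makes the average 0, and
    \<open>0 \<le> C\<close> suffices. This covers the empty segment \<open>{1..<2 ^ 0}\<close> and
    the permuted average at \<open>n = 0\<close>.\<close>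
  case False
  moreover have "0 \<le> C" using assms[of undefined] by linarith
  ultimately show ?thesis by (auto simp: avg_def)
qed

lemma (in prob_space) integrable_avg_square:
  assumes "\<And>i. i \<in> I \<Longrightarrow> X i \<in> M \<rightarrow>\<^sub>M borel" "h \<in> borel_measurable borel" "\<And>x. \<bar>h x\<bar> \<le> C"
  shows "integrable M (\<lambda>\<omega>. (avg X I h \<omega>)\<^sup>2)"
proof -
  note [measurable] = measurable_avg[of I X M h, OF assms(1,2)]
  show ?thesis
    by (rule integrable_const_bound[of _ "C\<^sup>2"])
       (auto simp: abs_le_square_iff[symmetric] intro!: order_trans[OF abs_avg_le[of h C]] assms(3))
qed

text \<open>The cross terms factorise by the branching property, and only the \<open>2 ^ q\<close> diagonal terms
  contribute an error.\<close>

lemma second_moment_generation_Suc: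
  fixes X :: "nat \<Rightarrow> 'w \<Rightarrow> 'a::metric_space"
  assumes X: "bifurcating_markov_chain M F X \<nu> P"
    and h: "h \<in> borel_measurable borel" and C: "\<And>x. \<bar>h x\<bar> \<le> C"
  shows "(\<integral>\<omega>. (avg X (generation (Suc q)) h \<omega>)\<^sup>2 \<partial>M)
    \<le> (\<integral>\<omega>. (avg X (generation q) (\<lambda>x. \<integral>y. h y \<partial>induced_kernel P x) \<omega>)\<^sup>2 \<partial>M) + C\<^sup>2 / 2 ^ q"
proof -
  interpret prob_space M using X by (simp add: bifurcating_markov_chain_def)
  have P: "T_transition P" using X by (simp add: bifurcating_markov_chain_def)
  \<comment> \<open>\<open>U n\<close> is the total of h over the two daughters of \<open>n\<close>;
    \<open>V n\<close>, twice Qh at the mother, is its conditional mean given generation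
    \<open>q\<close>.\<close>
  define u where "u yz = h (fst yz) + h (snd yz)" for yz
  define U where "U n \<omega> = u (X (2 * n) \<omega>, X (2 * n + 1) \<omega>)" for n \<omega>
  define k where "k x = (\<integral>y. h y \<partial>induced_kernel P x)" for x
  define V where "V n \<omega> = 2 * k (X n \<omega>)" for n \<omega>
  note [measurable] = h
  have u: "u \<in> borel_measurable (borel \<Otimes>\<^sub>M borel)" unfolding u_def by measurable
  have u_le: "\<bar>u yz\<bar> \<le> 2 * C" for yz
    unfolding u_def using C[of "fst yz"] C[of "snd yz"] by linarith
  have U_le: "\<bar>U n \<omega>\<bar> \<le> 2 * C" for n \<omega> by (simp add: U_def u_le)
  have Pu: "(\<integral>yz. u yz \<partial>P x) = 2 * k x" for x
    unfolding k_def u_def by (subst integral_induced_kernel[OF P h C]) simp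
  have k: "k \<in> borel_measurable borel" and k_le: "\<bar>k x\<bar> \<le> C" for x
    unfolding k_def using measurable_integral_induced_kernel[OF P h C]
      abs_integral_induced_kernel_le[OF P h C] by auto
  have C0: "0 \<le> C" using C[of undefined] by linarith
  have tr: "n \<in> tree" "2 * n \<in> tree" "Suc (2 * n) \<in> tree" if "n \<in> generation q" for n
    using that generation_subset_tree[of q] by (auto simp: tree_def)
  have X_meas: "X n \<in> M \<rightarrow>\<^sub>M borel" if "n \<in> tree" for n
    using measurable_bifurcating_markov_chain[OF X that] .
  have U: "U n \<in> borel_measurable M" if "n \<in> generation q" for n
  proof -
    note [measurable] = X_meas[OF tr(2)[OF that]] X_meas[OF tr(3)[OF that]]
    show ?thesis unfolding U_def u_def by simp
  qed
  have kX: "(\<lambda>\<omega>. k (X n \<omega>)) \<in> borel_measurable M" if "n \<in> generation q" for n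
    by (rule measurable_compose[OF X_meas[OF tr(1)[OF that]] k])
  have int_U: "integrable M (\<lambda>\<omega>. U i \<omega> * U j \<omega>)" if "i \<in> generation q" "j \<in> generation q" for i j
  proof (rule integrable_const_bound[of _ "(2 * C) * (2 * C)"])
    show "AE \<omega> in M. norm (U i \<omega> * U j \<omega>) \<le> (2 * C) * (2 * C)"
      unfolding real_norm_def abs_mult by (intro AE_I2 mult_mono U_le) (use C0 in auto)
  qed (use U that in simp)
  have int_k: "integrable M (\<lambda>\<omega>. V i \<omega> * V j \<omega>)" if "i \<in> generation q" "j \<in> generation q" for i j
    by (rule integrable_const_bound[of _ "(2 * C) * (2 * C)"])
       (use kX that C0 k_le in \<open>auto simp: V_def abs_mult intro!: mult_mono\<close>)
  have le: "(\<integral>\<omega>. U i \<omega> * U j \<omega> \<partial>M)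
      \<le> (\<integral>\<omega>. V i \<omega> * V j \<omega> \<partial>M) + (if i = j then 4 * C\<^sup>2 else 0)"
    if ij: "i \<in> generation q" "j \<in> generation q" for i j
  proof (cases "i = j")
    \<comment> \<open>On the diagonal the crude bound
      \<open>\<bar>U i \<omega>\<bar> \<le> 2 * C\<close> is enough: there are only
      \<open>2 ^ q\<close> such terms. The integral of the square of \<open>V i\<close> is
      nonnegative and may be added.\<close>
    case True
    have "U i \<omega> * U i \<omega> \<le> 4 * C\<^sup>2" for \<omega>
      using abs_le_square_iff[of "U i \<omega>" "2 * C"] U_le[of i \<omega>] C0 by (simp add: power2_eq_square)
    then have "(\<integral>\<omega>. U i \<omega> * U i \<omega> \<partial>M) \<le> (\<integral>\<omega>. 4 * C\<^sup>2 \<partial>M)"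
      using ij int_U by (intro integral_mono) auto
    also have "\<dots> = 4 * C\<^sup>2" by (simp add: prob_space)
    finally have "(\<integral>\<omega>. U i \<omega> * U i \<omega> \<partial>M) \<le> 4 * C\<^sup>2" .
    moreover have "0 \<le> (\<integral>\<omega>. V i \<omega> * V i \<omega> \<partial>M)"
      by (rule Bochner_Integration.integral_nonneg) simp
    ultimately have "(\<integral>\<omega>. U i \<omega> * U i \<omega> \<partial>M) \<le> (\<integral>\<omega>. V i \<omega> * V i \<omega> \<partial>M) + 4 * C\<^sup>2"
      by linarith
    then show ?thesis using True by simp
  next
    case False
    then show ?thesis
      using bifurcating_markov_chain_pair[OF X ij False u u_le] by (simp add: U_def V_def Pu)
  qed
  let ?G = "generation q"
  have "(\<integral>\<omega>. (\<Sum>n\<in>?G. U n \<omega>)\<^sup>2 \<partial>M) = (\<Sum>i\<in>?G. \<Sum>j\<in>?G. \<integral>\<omega>. U i \<omega> * U j \<omega> \<partial>M)"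
    by (simp add: power2_eq_square sum_product int_U)
  also have "\<dots> \<le> (\<Sum>i\<in>?G. \<Sum>j\<in>?G. (\<integral>\<omega>. V i \<omega> * V j \<omega> \<partial>M) + (if i = j then 4 * C\<^sup>2 else 0))"
    by (intro sum_mono le)
  also have "\<dots> = (\<Sum>i\<in>?G. \<Sum>j\<in>?G. \<integral>\<omega>. V i \<omega> * V j \<omega> \<partial>M) + 2 ^ q * (4 * C\<^sup>2)"
    by (simp only: sum.distrib sum.delta' sum.delta finite_generation) (simp add: sum.delta)
  also have "(\<Sum>i\<in>?G. \<Sum>j\<in>?G. \<integral>\<omega>. V i \<omega> * V j \<omega> \<partial>M)
      = (\<integral>\<omega>. (\<Sum>n\<in>?G. V n \<omega>)\<^sup>2 \<partial>M)"
    by (simp add: power2_eq_square sum_product int_k)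
  \<comment> \<open>Since \<open>(2 ^ Suc q)\<^sup>2 = 4 * (2 ^ q)\<^sup>2\<close>, the 4 cancels
    the square of the factor 2 in \<open>V\<close>, and the diagonal total
    \<open>2 ^ q * (4 * C\<^sup>2)\<close> becomes \<open>C\<^sup>2 / 2 ^ q\<close>.\<close>
  finally have "(\<integral>\<omega>. (\<Sum>n\<in>?G. U n \<omega>)\<^sup>2 \<partial>M) / (2 ^ Suc q)\<^sup>2
     \<le> ((\<integral>\<omega>. (\<Sum>n\<in>?G. V n \<omega>)\<^sup>2 \<partial>M) + 2 ^ q * (4 * C\<^sup>2)) / (2 ^ Suc q)\<^sup>2"
    by (rule divide_right_mono) simp
  also have "\<dots> = (\<integral>\<omega>. (\<Sum>n\<in>?G. V n \<omega>)\<^sup>2 \<partial>M) / (2 ^ Suc q)\<^sup>2 + C\<^sup>2 / 2 ^ q"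
    by (simp add: add_divide_distrib power2_eq_square)
  also have "(\<integral>\<omega>. (\<Sum>n\<in>?G. V n \<omega>)\<^sup>2 \<partial>M) / (2 ^ Suc q)\<^sup>2 = (\<integral>\<omega>. (avg X ?G k \<omega>)\<^sup>2 \<partial>M)"
    by (simp add: V_def avg_def power_divide power_mult_distrib flip: sum_distrib_left)
  finally show ?thesis
    by (simp add: avg_def power_divide sum_generation_Suc U_def u_def k_def[abs_def] del: power_Suc)
qed

text \<open>Peeling the youngest generation replaces h by Qh and costs the diagonal error of its
  mothers' generation. The induction therefore has to range over all h with the bound
  \<open>C\<close>.\<close>

lemma second_moment_generation_add:
  fixes X :: "nat \<Rightarrow> 'w \<Rightarrow> 'a::metric_space"
  assumes X: "bifurcating_markov_chain M F X \<nu> P"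
    and h: "h \<in> borel_measurable borel" and C: "\<And>x. \<bar>h x\<bar> \<le> C"
  shows "(\<integral>\<omega>. (avg X (generation (p + k)) h \<omega>)\<^sup>2 \<partial>M)
    \<le> (\<integral>\<omega>. (avg X (generation p) (\<lambda>x. \<integral>y. h y \<partial>induced_law P k x) \<omega>)\<^sup>2 \<partial>M)
       + (\<Sum>j<k. C\<^sup>2 / 2 ^ (p + j))"
  using h C
proof (induction k arbitrary: h)
  case 0
  have "(\<integral>y. h y \<partial>return borel x) = h x" for x
    by (rule integral_return) (use 0 in auto)
  then show ?case by simp
next
  case (Suc k)
  have P: "T_transition P" using X by (simp add: bifurcating_markov_chain_def)
  let ?k = "\<lambda>x. \<integral>y. h y \<partial>induced_kernel P x"
  have "?k \<in> borel_measurable borel" "\<And>x. \<bar>?k x\<bar> \<le> C"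
    by (intro measurable_integral_induced_kernel[OF P Suc.prems]
        abs_integral_induced_kernel_le[OF P Suc.prems])+
  from Suc.IH[OF this] second_moment_generation_Suc[OF X Suc.prems, of "p + k"]
  show ?case
    by (simp add: integral_induced_law_Suc[OF P Suc.prems] del: induced_law.simps)
qed

lemma second_moment_generation_tendsto_0:
  fixes X :: "nat \<Rightarrow> 'w \<Rightarrow> 'a::metric_space"
  assumes X: "bifurcating_markov_chain M F X \<nu> P"
    and h: "h \<in> borel_measurable borel" and C: "\<And>x. \<bar>h x\<bar> \<le> C"
    and lim: "\<And>x. (\<lambda>k. \<integral>y. h y \<partial>induced_law P k x) \<longlonglongrightarrow> 0"
  shows "(\<lambda>q. \<integral>\<omega>. (avg X (generation q) h \<omega>)\<^sup>2 \<partial>M) \<longlonglongrightarrow> 0"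
proof (rule LIMSEQ_I)
  interpret prob_space M using X by (simp add: bifurcating_markov_chain_def)
  have P: "T_transition P" using X by (simp add: bifurcating_markov_chain_def)
  have Qk: "(\<lambda>x. \<integral>y. h y \<partial>induced_law P k x) \<in> borel_measurable borel
      \<and> (\<forall>x. \<bar>\<integral>y. h y \<partial>induced_law P k x\<bar> \<le> C)" for k
    using h C
  proof (induction k arbitrary: h)
    case 0
    have "(\<integral>y. h y \<partial>return borel x) = h x" for x
      by (rule integral_return) (use 0 in auto)
    with 0 show ?case by simp
  next
    case (Suc k)
    show ?case unfolding integral_induced_law_Suc[OF P Suc.prems]
      by (rule Suc.IH[OF measurable_integral_induced_kernel[OF P Suc.prems]
          abs_integral_induced_kernel_le[OF P Suc.prems]])
  qed
  have X_meas: "X n \<in> M \<rightarrow>\<^sub>M borel" if "n \<in> generation p" for n p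
    using measurable_bifurcating_markov_chain[OF X] generation_subset_tree that by blast
  \<comment> \<open>For fixed \<open>p\<close> only finitely many vertices occur, so the pointwise
    limit of Q^k h passes to the average at every \<omega>, while the uniform bound \<open>C\<close>
    gives a constant dominating function.\<close>
  have lim_p:
    "(\<lambda>k. \<integral>\<omega>. (avg X (generation p) (\<lambda>x. \<integral>y. h y \<partial>induced_law P k x) \<omega>)\<^sup>2 \<partial>M) 
      \<longlonglongrightarrow> (\<integral>\<omega>. 0 \<partial>M)" for p
  proof (rule integral_dominated_convergence[where w="\<lambda>_. C\<^sup>2"])
    fix k
    note [measurable] = measurable_avg[of "generation p", OF X_meas[of _ p] conjunct1[OF Qk[of k]]]
    show "(\<lambda>\<omega>. (avg X (generation p) (\<lambda>x. \<integral>y. h y \<partial>induced_law P k x) \<omega>)\<^sup>2) \<in> borel_measurable M"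
      by measurable
    show "AE \<omega> in M. norm ((avg X (generation p) (\<lambda>x. \<integral>y. h y \<partial>induced_law P k x) \<omega>)\<^sup>2) \<le> C\<^sup>2"
      using Qk by (auto simp: abs_le_square_iff[symmetric] intro!: order_trans[OF abs_avg_le[of _ C]])
  next
    show "AE \<omega> in M. (\<lambda>k. (avg X (generation p) (\<lambda>x. \<integral>y. h y \<partial>induced_law P k x) \<omega>)\<^sup>2) \<longlonglongrightarrow> 0"
    proof (rule AE_I2)
      fix \<omega>
      have "(\<lambda>k. (avg X (generation p) (\<lambda>x. \<integral>y. h y \<partial>induced_law P k x) \<omega>)\<^sup>2)
          \<longlonglongrightarrow> ((\<Sum>i\<in>generation p. 0) / real (card (generation p)))\<^sup>2"
        unfolding avg_def by (intro tendsto_intros lim) simp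
      then show "(\<lambda>k. (avg X (generation p) (\<lambda>x. \<integral>y. h y \<partial>induced_law P k x) \<omega>)\<^sup>2) \<longlonglongrightarrow> 0"
        by simp
    qed
  qed simp_all
  fix e :: real assume e: "0 < e"
  \<comment> \<open>The order of choice matters: \<open>p\<close> is fixed first, making the
    accumulated error less than \<open>e / 2\<close> for every \<open>k\<close> at once by the
    geometric series; the threshold \<open>k0\<close> is then allowed to depend on
    \<open>p\<close>.\<close>
  have "(\<lambda>p. C\<^sup>2 * 2 * (1 / 2) ^ p) \<longlonglongrightarrow> C\<^sup>2 * 2 * 0"
    by (intro tendsto_intros LIMSEQ_realpow_zero) auto
  then have "eventually (\<lambda>p. C\<^sup>2 * 2 * (1 / 2) ^ p < e / 2) sequentially"
    by (rule order_tendstoD) (use e in simp)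
  then obtain p where p: "C\<^sup>2 * 2 * (1 / 2) ^ p < e / 2"
    by (auto simp: eventually_sequentially)
  have geo: "(\<Sum>j<k. C\<^sup>2 / 2 ^ (p + j)) \<le> C\<^sup>2 * 2 * (1 / 2) ^ p" for k
  proof -
    have "(\<Sum>j<k. C\<^sup>2 / 2 ^ (p + j)) = C\<^sup>2 * (1 / 2) ^ p * (\<Sum>j<k. (1 / 2) ^ j)"
      by (simp add: sum_distrib_left power_add power_divide)
    also have "(\<Sum>j<k. (1 / 2) ^ j) = 2 * (1 - (1 / 2 :: real) ^ k)"
      by (simp add: sum_gp_strict)
    also have "C\<^sup>2 * (1 / 2) ^ p * (2 * (1 - (1 / 2) ^ k)) \<le> C\<^sup>2 * (1 / 2) ^ p * 2"
      by (intro mult_left_mono) auto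
    finally show ?thesis by (simp add: ac_simps)
  qed
  have "eventually (\<lambda>k.
      (\<integral>\<omega>. (avg X (generation p) (\<lambda>x. \<integral>y. h y \<partial>induced_law P k x) \<omega>)\<^sup>2 \<partial>M) < e / 2) sequentially"
    using lim_p[of p] by (rule order_tendstoD) (use e in simp)
  then obtain k0 where k0: "\<And>k. k0 \<le> k \<Longrightarrow>
      (\<integral>\<omega>. (avg X (generation p) (\<lambda>x. \<integral>y. h y \<partial>induced_law P k x) \<omega>)\<^sup>2 \<partial>M) < e / 2"
    by (auto simp: eventually_sequentially)
  show "\<exists>q0. \<forall>q\<ge>q0. norm ((\<integral>\<omega>. (avg X (generation q) h \<omega>)\<^sup>2 \<partial>M) - 0) < e"
  proof (intro exI allI impI)
    fix q assume q: "p + k0 \<le> q"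
    then have k: "q = p + (q - p)" "k0 \<le> q - p" by arith+
    have "0 \<le> (\<integral>\<omega>. (avg X (generation q) h \<omega>)\<^sup>2 \<partial>M)"
      by (rule Bochner_Integration.integral_nonneg) simp
    then show "norm ((\<integral>\<omega>. (avg X (generation q) h \<omega>)\<^sup>2 \<partial>M) - 0) < e"
      using second_moment_generation_add[OF X h C, of p "q - p"] geo[of "q - p"] k0[OF k(2)] p k(1) by simp
  qed
qed

section \<open>Sampling without replacement\<close>

text \<open>Composing on the right with a permutation of \<open>G\<close> that takes
  \<open>(i, j)\<close> to \<open>(i', j')\<close> only reorders the sum over all
  permutations.\<close>

lemma sum_permutes_two_points:
  fixes c :: "'b \<Rightarrow> 'b \<Rightarrow> real"
  assumes "i \<in> G" "j \<in> G" "i \<noteq> j" "i' \<in> G" "j' \<in> G" "i' \<noteq> j'"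
  shows "(\<Sum>p | p permutes G. c (p i) (p j)) = (\<Sum>p | p permutes G. c (p i') (p j'))"
proof -
  \<comment> \<open>The first swap sends \<open>i\<close> to \<open>i'\<close> and \<open>j\<close>
    to some point, possibly \<open>i\<close>. The second sends that point to \<open>j'\<close>; it
    leaves \<open>i'\<close> alone, because \<open>i'\<close> differs from both points it
    exchanges.\<close>
  define \<tau> where
    "\<tau> = Transposition.transpose (Transposition.transpose i i' j) j' \<circ> Transposition.transpose i i'"
  have "Transposition.transpose i i' j \<in> G"
    using assms by (auto simp: Transposition.transpose_def)
  then have \<tau>: "\<tau> permutes G"
    unfolding \<tau>_def using assms by (intro permutes_compose permutes_swap_id) auto
  have "\<tau> i = i'" "\<tau> j = j'"
    using assms by (auto simp: \<tau>_def Transposition.transpose_def)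
  then show ?thesis
    using sum_permutations_compose_right[OF \<tau>, of "\<lambda>p. c (p i) (p j)"] by simp
qed

text \<open>By symmetry all ordered pairs of distinct points give the same sum, so multiplying by
  their number amounts to summing over all of them. After exchanging the sums, each single
  permutation merely rearranges the off-diagonal pairs.\<close>

lemma sum_permutes_off_diagonal:
  fixes c :: "'b \<Rightarrow> 'b \<Rightarrow> real"
  assumes G: "finite G" and ij: "i \<in> G" "j \<in> G" "i \<noteq> j"
  shows "(\<Sum>p | p permutes G. c (p i) (p j)) * (real (card G) * (real (card G) - 1))
    = fact (card G) * (\<Sum>k\<in>G. \<Sum>l\<in>G - {k}. c k l)"
proof -
  have reindex: "(\<Sum>k\<in>G. \<Sum>l\<in>G - {k}. c (p k) (p l)) = (\<Sum>k\<in>G. \<Sum>l\<in>G - {k}. c k l)"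
    if p: "p permutes G" for p
  proof -
    have "(\<Sum>l\<in>G - {k}. c (p k) (p l)) = (\<Sum>l\<in>G - {p k}. c (p k) l)" if "k \<in> G" for k
    proof (rule sum.reindex_bij_betw)
      have "p ` (G - {k}) = G - {p k}"
        using permutes_image[OF p] permutes_inj[OF p] by (auto simp: inj_def image_set_diff)
      then show "bij_betw p (G - {k}) (G - {p k})"
        using permutes_inj_on[OF p] by (simp add: bij_betw_def)
    qed
    then have "(\<Sum>k\<in>G. \<Sum>l\<in>G - {k}. c (p k) (p l)) = (\<Sum>k\<in>G. \<Sum>l\<in>G - {p k}. c (p k) l)"
      by simp
    also have "\<dots> = (\<Sum>k\<in>G. \<Sum>l\<in>G - {k}. c k l)"
      by (rule sum.reindex_bij_betw[OF permutes_imp_bij[OF p]])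
    finally show ?thesis .
  qed
  have "real (card (G - {k})) = real (card G) - 1" if "k \<in> G" for k
    using that G card_gt_0_iff[of G] by (subst card_Diff_singleton) (auto simp: of_nat_diff Suc_le_eq)
  then have "(\<Sum>p | p permutes G. c (p i) (p j)) * (real (card G) * (real (card G) - 1))
      = (\<Sum>k\<in>G. \<Sum>l\<in>G - {k}. \<Sum>p | p permutes G. c (p i) (p j))"
    by simp
  also have "\<dots> = (\<Sum>k\<in>G. \<Sum>l\<in>G - {k}. \<Sum>p | p permutes G. c (p k) (p l))"
    using ij by (intro sum.cong refl sum_permutes_two_points) auto
  also have "\<dots> = (\<Sum>p | p permutes G. \<Sum>k\<in>G. \<Sum>l\<in>G - {k}. c (p k) (p l))"
    by (subst (2) sum.swap, subst sum.swap) rule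
  also have "\<dots> = fact (card G) * (\<Sum>k\<in>G. \<Sum>l\<in>G - {k}. c k l)"
    using card_permutations[OF refl G] by (simp add: reindex)
  finally show ?thesis .
qed

lemma square_sum_eq_off_diagonal:
  fixes y :: "'b \<Rightarrow> real"
  assumes "finite I"
  shows "(\<Sum>i\<in>I. y i)\<^sup>2 = (\<Sum>i\<in>I. (y i)\<^sup>2) + (\<Sum>i\<in>I. \<Sum>j\<in>I - {i}. y i * y j)"
proof -
  have "(\<Sum>j\<in>I. y i * y j) = (y i)\<^sup>2 + (\<Sum>j\<in>I - {i}. y i * y j)" if "i \<in> I" for i
    using that assms by (simp add: sum.remove power2_eq_square)
  then show ?thesis
    by (simp add: power2_eq_square[of "sum y I"] sum_product sum.distrib)
qed

text \<open>This is the second moment of a uniform sample without replacement, of size m from N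
  values. The diagonal gives at most m C^2. Each off-diagonal pair has mean T / (N (N - 1)), and m
  (m - 1) / (N (N - 1)) is at most (m / N)^2 because m is at most N.\<close>

lemma mean_square_permuted_sum_le:
  fixes x :: "'b \<Rightarrow> real"
  assumes G: "finite G" and I: "I \<subseteq> G" and C: "\<And>k. \<bar>x k\<bar> \<le> C"
  shows "(\<Sum>p | p permutes G. (\<Sum>i\<in>I. x (p i))\<^sup>2) / fact (card G)
    \<le> real (card I) * C\<^sup>2 + (real (card I) / real (card G) * (\<Sum>k\<in>G. x k))\<^sup>2"
proof -
  let ?Q = "{p. p permutes G}"
  define N where "N = real (card G)"
  define m where "m = real (card I)"
  define T where "T = (\<Sum>k\<in>G. \<Sum>l\<in>G - {k}. x k * x l)"
  have finI: "finite I" using G I by (rule finite_subset[rotated])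
  have card_Q: "card ?Q = fact (card G)" using card_permutations[OF refl G] .
  have mN: "m \<le> N" using card_mono[OF G I] by (simp add: m_def N_def)
  have x2: "(x k)\<^sup>2 \<le> C\<^sup>2" for k
    using abs_le_square_iff[of "x k" C] C[of k] by linarith
  have T_le: "T \<le> (\<Sum>k\<in>G. x k)\<^sup>2"
    using square_sum_eq_off_diagonal[OF G, of x] by (simp add: T_def sum_nonneg)
  have diag: "(\<Sum>p\<in>?Q. \<Sum>i\<in>I. (x (p i))\<^sup>2) \<le> fact (card G) * (m * C\<^sup>2)"
  proof -
    have "(\<Sum>p\<in>?Q. \<Sum>i\<in>I. (x (p i))\<^sup>2) \<le> (\<Sum>p\<in>?Q. \<Sum>i\<in>I. C\<^sup>2)"
      by (intro sum_mono x2)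
    then show ?thesis by (simp add: card_Q m_def)
  qed
  have off: "(\<Sum>i\<in>I. \<Sum>j\<in>I - {i}. \<Sum>p\<in>?Q. x (p i) * x (p j))
      \<le> fact (card G) * ((m / N)\<^sup>2 * (\<Sum>k\<in>G. x k)\<^sup>2)"
  proof (cases "card I \<le> 1")
    \<comment> \<open>A sample of at most one point has no off-diagonal pairs. This case is split
      off because \<open>N - 1\<close> may vanish here; otherwise \<open>2 \<le> m \<le> N\<close>
      makes the quotients legitimate.\<close>
    case True
    then have empty: "I - {i} = {}" if "i \<in> I" for i
      using that finI by (auto simp: card_le_Suc0_iff_eq)
    have "(\<Sum>j\<in>I - {i}. \<Sum>p\<in>?Q. x (p i) * x (p j)) = 0" if "i \<in> I" for i
      by (simp only: empty[OF that] sum.empty)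
    then show ?thesis by simp
  next
    case False
    then have m: "2 \<le> m" by (simp add: m_def)
    have "(\<Sum>p\<in>?Q. x (p i) * x (p j)) = fact (card G) * (T / (N * (N - 1)))"
      if "i \<in> I" "j \<in> I - {i}" for i j
      using sum_permutes_off_diagonal[OF G, of i j "\<lambda>a b. x a * x b"] that I m mN
      by (auto simp: T_def N_def field_simps)
    then have "(\<Sum>i\<in>I. \<Sum>j\<in>I - {i}. \<Sum>p\<in>?Q. x (p i) * x (p j))
        = (\<Sum>i\<in>I. \<Sum>j\<in>I - {i}. fact (card G) * (T / (N * (N - 1))))"
      by (intro sum.cong refl) auto
    also have "\<dots> = m * (m - 1) * (fact (card G) * (T / (N * (N - 1))))"
      using False finI by (simp add: m_def card_Diff_singleton of_nat_diff)
    also have "\<dots> = fact (card G) * (m * (m - 1) / (N * (N - 1)) * T)"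
      by simp
    also have "\<dots> \<le> fact (card G) * ((m / N)\<^sup>2 * (\<Sum>k\<in>G. x k)\<^sup>2)"
    proof (rule mult_left_mono)
      \<comment> \<open>\<open>T\<close> can be negative, so it is first replaced by the nonnegative
        square; only then may the coefficient be enlarged.\<close>
      have "m * (m - 1) / (N * (N - 1)) * T \<le> m * (m - 1) / (N * (N - 1)) * (\<Sum>k\<in>G. x k)\<^sup>2"
        by (rule mult_left_mono[OF T_le]) (use m mN in auto)
      also have "m * (m - 1) / (N * (N - 1)) \<le> (m / N)\<^sup>2"
      proof -
        have "(m - 1) / (N - 1) \<le> m / N"
          using m mN by (simp add: field_simps)
        then have "m / N * ((m - 1) / (N - 1)) \<le> m / N * (m / N)"
          by (rule mult_left_mono) (use m mN in auto)
        then show ?thesis by (simp add: power2_eq_square)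
      qed
      then have "m * (m - 1) / (N * (N - 1)) * (\<Sum>k\<in>G. x k)\<^sup>2 \<le> (m / N)\<^sup>2 * (\<Sum>k\<in>G. x k)\<^sup>2"
        by (rule mult_right_mono) simp
      finally show "m * (m - 1) / (N * (N - 1)) * T \<le> (m / N)\<^sup>2 * (\<Sum>k\<in>G. x k)\<^sup>2" .
    qed simp
    finally show ?thesis .
  qed
  have "(\<Sum>p\<in>?Q. (\<Sum>i\<in>I. x (p i))\<^sup>2)
      = (\<Sum>p\<in>?Q. \<Sum>i\<in>I. (x (p i))\<^sup>2) + (\<Sum>p\<in>?Q. \<Sum>i\<in>I. \<Sum>j\<in>I - {i}. x (p i) * x (p j))"
    by (simp add: square_sum_eq_off_diagonal[OF finI] sum.distrib)
  also have "(\<Sum>p\<in>?Q. \<Sum>i\<in>I. \<Sum>j\<in>I - {i}. x (p i) * x (p j))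
      = (\<Sum>i\<in>I. \<Sum>j\<in>I - {i}. \<Sum>p\<in>?Q. x (p i) * x (p j))"
    by (subst sum.swap, subst (2) sum.swap) rule
  finally have "(\<Sum>p\<in>?Q. (\<Sum>i\<in>I. x (p i))\<^sup>2)
      \<le> fact (card G) * (m * C\<^sup>2 + (m / N)\<^sup>2 * (\<Sum>k\<in>G. x k)\<^sup>2)"
    using diag off by (simp add: distrib_left)
  then show ?thesis
    by (simp add: field_simps m_def N_def power_mult_distrib power_divide)
qed

section \<open>Averaging over the random permutation\<close>

text \<open>Measurability of \<open>Y\<close> and \<open>Z\<close> places their generated
  \<sigma>-fields inside \<open>A\<close> and \<open>B\<close>, so they inherit independence. This
  carries the \<sigma>-field form of independence between permutation and chain over to
  expectations.\<close>

lemma (in prob_space) integral_mult_indep_set: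
  fixes Y Z :: "'a \<Rightarrow> real"
  assumes indep: "indep_set (sets A) (sets B)" and sp: "space A = space M" "space B = space M"
    and Y: "Y \<in> borel_measurable A" "integrable M Y"
    and Z: "Z \<in> borel_measurable B" "integrable M Z"
  shows "(\<integral>\<omega>. Y \<omega> * Z \<omega> \<partial>M) = (\<integral>\<omega>. Y \<omega> \<partial>M) * (\<integral>\<omega>. Z \<omega> \<partial>M)"
proof (rule indep_var_lebesgue_integral[OF _ Y(2) Z(2)])
  have "sigma_sets (space M) {Y -` S \<inter> space M |S. S \<in> sets borel} \<subseteq> sets A"
    using measurable_sets[OF Y(1)] sp(1)
      sets.sigma_sets_subset[of "{Y -` S \<inter> space M |S. S \<in> sets borel}" A]
    by auto
  moreover have "sigma_sets (space M) {Z -` S \<inter> space M |S. S \<in> sets borel} \<subseteq> sets B"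
    using measurable_sets[OF Z(1)] sp(2)
      sets.sigma_sets_subset[of "{Z -` S \<inter> space M |S. S \<in> sets borel}" B]
    by auto
  ultimately have "indep_set (sigma_sets (space M) {Y -` S \<inter> space M |S. S \<in> sets borel})
      (sigma_sets (space M) {Z -` S \<inter> space M |S. S \<in> sets borel})"
    using indep unfolding indep_sets2_eq by blast
  then show "indep_var borel Y borel Z"
    using Y Z by (simp add: indep_var_eq borel_measurable_integrable)
qed

lemma measurable_vimage_algebra_component:
  assumes "n \<in> I" "\<And>i. i \<in> I \<Longrightarrow> Y i \<in> \<Omega> \<rightarrow> space (N i)"
  shows "Y n \<in> vimage_algebra \<Omega> (\<lambda>\<omega>. \<lambda>i\<in>I. Y i \<omega>) (\<Pi>\<^sub>M i\<in>I. N i) \<rightarrow>\<^sub>M N n"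
proof -
  have "(\<lambda>\<omega>. \<lambda>i\<in>I. Y i \<omega>) \<in> vimage_algebra \<Omega> (\<lambda>\<omega>. \<lambda>i\<in>I. Y i \<omega>) (\<Pi>\<^sub>M i\<in>I. N i) \<rightarrow>\<^sub>M (\<Pi>\<^sub>M i\<in>I. N i)"
    by (rule measurable_vimage_algebra1) (use assms in \<open>auto simp: space_PiM Pi_iff\<close>)
  from measurable_compose[OF this measurable_component_singleton[OF assms(1)]]
  show ?thesis using assms(1) by simp
qed

lemma restrict_id_permutes_generation:
  assumes "uniform_generation_permutation M \<pi>" "\<omega> \<in> space M"
  shows "restrict_id (\<pi> \<omega>) (generation q) permutes generation q"
proof (rule bij_imp_permutes)
  have "inj_on (\<pi> \<omega>) (generation q)" "\<pi> \<omega> ` generation q = generation q"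
    using assms generation_subset_tree
    by (auto simp: uniform_generation_permutation_def bij_betw_def intro: inj_on_subset)
  then show "bij_betw (restrict_id (\<pi> \<omega>) (generation q)) (generation q) (generation q)"
    by (intro bij_betw_restrict_id) (auto simp: bij_betw_def)
qed (simp add: restrict_id_def)

lemma measure_restrict_id_eq:
  assumes M: "prob_space M" and \<pi>: "uniform_generation_permutation M \<pi>" and p: "p permutes generation q"
  shows "measure M {\<omega> \<in> space M. restrict_id (\<pi> \<omega>) (generation q) = p} = 1 / fact (2 ^ q)"
proof -
  let ?Q = "{p. p permutes generation q}"
  let ?R = "\<lambda>\<omega>. restrict_id (\<pi> \<omega>) (generation q)"
  interpret prob_space M by (rule M)
  have R: "?R \<in> M \<rightarrow>\<^sub>M count_space ?Q"
    using \<pi> by (auto simp: uniform_generation_permutation_def indep_vars_def)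
  have "{\<omega> \<in> space M. ?R \<omega> = p} = ?R -` {p} \<inter> space M"
    by auto
  then have "measure M {\<omega> \<in> space M. ?R \<omega> = p} = measure (distr M (count_space ?Q) ?R) {p}"
    using p by (simp add: measure_distr[OF R])
  also have "distr M (count_space ?Q) ?R = uniform_count_measure ?Q"
    using \<pi> by (simp add: uniform_generation_permutation_def)
  also have "measure \<dots> {p} = 1 / fact (2 ^ q)"
    using p finite_permutations[OF finite_generation[of q]]
      card_permutations[OF card_generation finite_generation, of q]
    by (simp add: measure_uniform_count_measure)
  finally show ?thesis .
qed

text \<open>The sample space splits into finitely many events, one per permutation of the
  generation. Each event lies in \<sigma>(\<pi>) and has probability 1 / (2^q)!, and
  \<open>Z p\<close> is measurable for \<sigma>(X), so every term factorises. It is Fubini's theorem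
  for a finitely valued independent variable.\<close>

lemma expectation_permuted:
  fixes X :: "nat \<Rightarrow> 'w \<Rightarrow> 'a::metric_space" and Z :: "(nat \<Rightarrow> nat) \<Rightarrow> 'w \<Rightarrow> real"
  assumes M: "prob_space M" and \<pi>: "uniform_generation_permutation M \<pi>" and indep: "indep_of_chain M \<pi> X"
    and Z: "\<And>p. p permutes generation q \<Longrightarrow>
      Z p \<in> borel_measurable (vimage_algebra (space M) (\<lambda>\<omega>. \<lambda>n\<in>tree. X n \<omega>) (\<Pi>\<^sub>M n\<in>tree. borel))"
    and int: "\<And>p. p permutes generation q \<Longrightarrow> integrable M (Z p)"
  shows "(\<integral>\<omega>. Z (restrict_id (\<pi> \<omega>) (generation q)) \<omega> \<partial>M)
    = (\<Sum>p | p permutes generation q. \<integral>\<omega>. Z p \<omega> \<partial>M) / fact (2 ^ q)"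
proof -
  let ?G = "generation q"
  let ?Q = "{p. p permutes ?G}"
  let ?R = "\<lambda>\<omega>. restrict_id (\<pi> \<omega>) ?G"
  let ?A = "vimage_algebra (space M) (\<lambda>\<omega>. \<lambda>n\<in>tree. \<pi> \<omega> n) (\<Pi>\<^sub>M n\<in>tree. count_space UNIV)"
  let ?B = "vimage_algebra (space M) (\<lambda>\<omega>. \<lambda>n\<in>tree. X n \<omega>) (\<Pi>\<^sub>M n\<in>tree. borel)"
  interpret prob_space M by (rule M)
  have ind: "indep_set (sets ?A) (sets ?B)"
    using indep by (simp add: indep_of_chain_def)
  define D where "D p = {\<omega> \<in> space M. ?R \<omega> = p}" for p
  have D_A: "D p \<in> sets ?A" if p: "p permutes ?G" for p
  proof -
    \<comment> \<open>Outside the generation both maps are the identity, so the event is decided by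
      finitely many coordinates of \<open>\<pi>\<close>, each measurable for
      \<open>?A\<close>.\<close>
    have "?R \<omega> = p \<longleftrightarrow> (\<forall>n\<in>?G. \<pi> \<omega> n = p n)" for \<omega>
      using permutes_not_in[OF p] by (auto simp: restrict_id_def fun_eq_iff)
    then have "D p = {\<omega> \<in> space ?A. \<forall>n\<in>?G. \<pi> \<omega> n = p n}"
      by (simp add: D_def)
    also have "\<dots> \<in> sets ?A"
    proof (rule sets.sets_Collect_finite_All[OF _ finite_generation])
      fix n assume "n \<in> ?G"
      then have "(\<lambda>\<omega>. \<pi> \<omega> n) \<in> ?A \<rightarrow>\<^sub>M count_space UNIV"
        using generation_subset_tree by (intro measurable_vimage_algebra_component) auto
      then show "{\<omega> \<in> space ?A. \<pi> \<omega> n = p n} \<in> sets ?A"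
        by measurable
    qed
    finally show ?thesis .
  qed
  have D_M: "D p \<in> sets M" if "p permutes ?G" for p
    using D_A[OF that] ind unfolding indep_sets2_eq by blast
  have "(\<integral>\<omega>. Z (?R \<omega>) \<omega> \<partial>M) = (\<integral>\<omega>. (\<Sum>p\<in>?Q. indicator (D p) \<omega> * Z p \<omega>) \<partial>M)"
  proof (rule Bochner_Integration.integral_cong[OF refl])
    fix \<omega> assume \<omega>: "\<omega> \<in> space M"
    have "(\<Sum>p\<in>?Q. indicator (D p) \<omega> * Z p \<omega>) = (\<Sum>p\<in>?Q. if p = ?R \<omega> then Z p \<omega> else 0)"
      using \<omega> by (intro sum.cong) (auto simp: D_def)
    then show "Z (?R \<omega>) \<omega> = (\<Sum>p\<in>?Q. indicator (D p) \<omega> * Z p \<omega>)"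
      using restrict_id_permutes_generation[OF \<pi> \<omega>, of q] finite_permutations[OF finite_generation[of q]]
      by simp
  qed
  also have "\<dots> = (\<Sum>p\<in>?Q. \<integral>\<omega>. indicator (D p) \<omega> * Z p \<omega> \<partial>M)"
    using D_M int by (intro Bochner_Integration.integral_sum)
      (auto intro: integrable_real_mult_indicator simp: mult.commute)
  also have "\<dots> = (\<Sum>p\<in>?Q. (\<integral>\<omega>. indicator (D p) \<omega> \<partial>M) * (\<integral>\<omega>. Z p \<omega> \<partial>M))"
    using D_A D_M Z int by (intro sum.cong refl integral_mult_indep_set[OF ind])
      (auto simp: emeasure_eq_measure)
  also have "\<dots> = (\<Sum>p\<in>?Q. 1 / fact (2 ^ q) * (\<integral>\<omega>. Z p \<omega> \<partial>M))"
    using D_M measure_restrict_id_eq[OF M \<pi>, of _ q]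
    by (intro sum.cong) (auto simp: D_def)
  finally show ?thesis by (simp add: sum_divide_distrib)
qed

text \<open>Once the permutation is averaged out, the chain can be held fixed: at each \<omega> the
  sampling bound applies to the values \<open>h (X k \<omega>)\<close>, whose mean over the
  generation is \<open>avg X (generation q) h \<omega>\<close>.\<close>

lemma second_moment_permuted_le:
  fixes X :: "nat \<Rightarrow> 'w \<Rightarrow> 'a::metric_space"
  assumes M: "prob_space M" and \<pi>: "uniform_generation_permutation M \<pi>" and indep: "indep_of_chain M \<pi> X"
    and X: "\<And>n. n \<in> tree \<Longrightarrow> X n \<in> M \<rightarrow>\<^sub>M borel"
    and h: "h \<in> borel_measurable borel" and C: "\<And>x. \<bar>h x\<bar> \<le> C" and I: "I \<subseteq> generation q"
  shows "(\<integral>\<omega>. (\<Sum>i\<in>I. h (X (\<pi> \<omega> i) \<omega>))\<^sup>2 \<partial>M)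
    \<le> real (card I) * C\<^sup>2 + (real (card I))\<^sup>2 * (\<integral>\<omega>. (avg X (generation q) h \<omega>)\<^sup>2 \<partial>M)"
proof -
  let ?G = "generation q"
  let ?Q = "{p. p permutes ?G}"
  let ?B = "vimage_algebra (space M) (\<lambda>\<omega>. \<lambda>n\<in>tree. X n \<omega>) (\<Pi>\<^sub>M n\<in>tree. borel)"
  interpret prob_space M by (rule M)
  define Z where "Z p \<omega> = (\<Sum>i\<in>I. h (X (p i) \<omega>))\<^sup>2" for p \<omega>
  have tree: "p i \<in> tree" if "p permutes ?G" "i \<in> I" for p i
    using that I generation_subset_tree[of q] permutes_in_image[OF that(1)] by blast
  have Z_B: "Z p \<in> borel_measurable ?B" if p: "p permutes ?G" for p
  proof -
    have "X (p i) \<in> ?B \<rightarrow>\<^sub>M borel" if "i \<in> I" for i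
      using tree[OF p that] by (rule measurable_vimage_algebra_component) auto
    then show ?thesis
      unfolding Z_def[abs_def]
      by (intro borel_measurable_power borel_measurable_sum measurable_compose[OF _ h])
  qed
  have Z_int: "integrable M (Z p)" if p: "p permutes ?G" for p
  proof (rule integrable_const_bound[of _ "(real (card I) * C)\<^sup>2"])
    have "\<bar>\<Sum>i\<in>I. h (X (p i) \<omega>)\<bar> \<le> real (card I) * C" for \<omega>
      by (rule order_trans[OF sum_abs sum_bounded_above]) (rule C)
    then show "AE \<omega> in M. norm (Z p \<omega>) \<le> (real (card I) * C)\<^sup>2"
      by (intro AE_I2)
        (auto simp: Z_def abs_le_square_iff[symmetric] intro: order_trans[OF _ abs_ge_self])
    show "Z p \<in> borel_measurable M"
      unfolding Z_def[abs_def]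
      by (intro borel_measurable_power borel_measurable_sum measurable_compose[OF _ h] X tree[OF p])
  qed
  have "(\<integral>\<omega>. (\<Sum>i\<in>I. h (X (\<pi> \<omega> i) \<omega>))\<^sup>2 \<partial>M) = (\<integral>\<omega>. Z (restrict_id (\<pi> \<omega>) ?G) \<omega> \<partial>M)"
  proof -
    have "restrict_id (\<pi> \<omega>) ?G i = \<pi> \<omega> i" if "i \<in> I" for \<omega> i
      using that I by (auto simp: restrict_id_def)
    then show ?thesis by (simp add: Z_def)
  qed
  also have "\<dots> = (\<Sum>p\<in>?Q. \<integral>\<omega>. Z p \<omega> \<partial>M) / fact (2 ^ q)"
    by (rule expectation_permuted[OF M \<pi> indep Z_B Z_int])
  also have "\<dots> = (\<integral>\<omega>. (\<Sum>p\<in>?Q. Z p \<omega>) / fact (2 ^ q) \<partial>M)"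
    using Z_int by simp
  also have "\<dots> \<le> (\<integral>\<omega>. real (card I) * C\<^sup>2 + (real (card I))\<^sup>2 * (avg X ?G h \<omega>)\<^sup>2 \<partial>M)"
  proof (rule integral_mono)
    show "integrable M (\<lambda>\<omega>. (\<Sum>p\<in>?Q. Z p \<omega>) / fact (2 ^ q))"
      by (intro integrable_divide Bochner_Integration.integrable_sum Z_int) simp
    have "integrable M (\<lambda>\<omega>. (avg X ?G h \<omega>)\<^sup>2)"
      by (rule integrable_avg_square[OF X h C]) (use generation_subset_tree in auto)
    then show "integrable M (\<lambda>\<omega>. real (card I) * C\<^sup>2 + (real (card I))\<^sup>2 * (avg X ?G h \<omega>)\<^sup>2)"
      by simp
  next
    fix \<omega>
    show "(\<Sum>p\<in>?Q. Z p \<omega>) / fact (2 ^ q) \<le> real (card I) * C\<^sup>2 + (real (card I))\<^sup>2 * (avg X ?G h \<omega>)\<^sup>2"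
      using mean_square_permuted_sum_le[OF finite_generation I, of "\<lambda>k. h (X k \<omega>)" C] C
      by (simp add: Z_def avg_def power_mult_distrib power_divide)
  qed
  also have "\<dots> = real (card I) * C\<^sup>2 + (real (card I))\<^sup>2 * (\<integral>\<omega>. (avg X ?G h \<omega>)\<^sup>2 \<partial>M)"
  proof -
    have "integrable M (\<lambda>\<omega>. (avg X ?G h \<omega>)\<^sup>2)"
      by (rule integrable_avg_square[OF X h C]) (use generation_subset_tree in auto)
    then show ?thesis by (simp add: prob_space)
  qed
  finally show ?thesis .
qed

section \<open>Averages over initial segments\<close>

lemma UN_generation: "(\<Union>q<r. generation q) = {1..<2 ^ r}"
proof (induction r)
  case (Suc r)
  have "(\<Union>q<Suc r. generation q) = {1..<2 ^ r} \<union> {2 ^ r..<2 ^ Suc r}"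
    by (simp only: lessThan_Suc UN_insert Suc) (simp add: generation_def Un_commute)
  also have "\<dots> = {1..<2 ^ Suc r}"
    by (rule ivl_disj_un_two(3)) auto
  finally show ?case .
qed simp

lemma subtree_eq: "subtree r = {1..<2 ^ Suc r}"
  using UN_generation[of "Suc r"] by (simp add: subtree_def lessThan_Suc_atMost)

text \<open>The segment is a union of complete generations, and each of them is mapped onto
  itself.\<close>

lemma sum_permuted_initial:
  fixes g :: "nat \<Rightarrow> real"
  assumes "uniform_generation_permutation M \<pi>" "\<omega> \<in> space M"
  shows "(\<Sum>i\<in>{1..<2 ^ r}. g (\<pi> \<omega> i)) = (\<Sum>i\<in>{1..<2 ^ r}. g i)"
proof (rule sum.reindex_bij_betw)
  have "\<pi> \<omega> ` (\<Union>q<r. generation q) = (\<Union>q<r. generation q)"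
    using assms by (simp add: uniform_generation_permutation_def image_UN)
  moreover have "inj_on (\<pi> \<omega>) tree"
    using assms by (simp add: uniform_generation_permutation_def bij_betw_def)
  then have "inj_on (\<pi> \<omega>) {1..<2 ^ r}"
    by (rule inj_on_subset) (auto simp: tree_def)
  ultimately show "bij_betw (\<pi> \<omega>) {1..<2 ^ r} {1..<2 ^ r}"
    by (simp add: bij_betw_def UN_generation)
qed

lemma sum_initial_eq_avg: "(\<Sum>i\<in>{1..<2 ^ r}. h (X i \<omega>)) = (2 ^ r - 1) * avg X {1..<2 ^ r} h \<omega>"
proof (cases "r = 0")
  case False
  then have "(1::real) < 2 ^ r" by (intro one_less_power) auto
  then show ?thesis by (simp add: avg_def of_nat_diff)
qed simp

text \<open>The square is convex, and the last generation contains more than half of the vertices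
  whenever it is appended. For \<open>r = 0\<close> the older segment is empty and its average is
  0.\<close>

lemma avg_initial_Suc_square_le:
  "(avg X {1..<2 ^ Suc r} h \<omega>)\<^sup>2 \<le> (avg X {1..<2 ^ r} h \<omega>)\<^sup>2 / 2 + (avg X (generation r) h \<omega>)\<^sup>2"
proof -
  define u where "u = avg X {1..<2 ^ r} h \<omega>"
  define v where "v = avg X (generation r) h \<omega>"
  \<comment> \<open>The share of generation \<open>r\<close> among the \<open>2 ^ Suc r - 1\<close>
    vertices; it lies between 1/2 and 1.\<close>
  define l :: real where "l = 2 ^ r / (2 ^ Suc r - 1)"
  have pos: "(1::real) \<le> 2 ^ r" by simp
  have "(\<Sum>i\<in>{1..<2 ^ r}. h (X i \<omega>)) = (2 ^ r - 1) * u"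
    unfolding u_def by (rule sum_initial_eq_avg)
  moreover have "(\<Sum>i\<in>generation r. h (X i \<omega>)) = 2 ^ r * v"
    by (simp add: v_def avg_def)
  moreover have "{1..<2 ^ Suc r} = {1..<2 ^ r} \<union> generation r" "{1..<2 ^ r} \<inter> generation r = {}"
    using ivl_disj_un_two(3)[of 1 "2 ^ r" "2 ^ Suc r :: nat"] by (auto simp: generation_def)
  ultimately have "(\<Sum>i\<in>{1..<2 ^ Suc r}. h (X i \<omega>)) = (2 ^ r - 1) * u + 2 ^ r * v"
    by (simp only: sum.union_disjoint finite_atLeastLessThan finite_generation)
  moreover have "real (card {1..<2 ^ Suc r :: nat}) = 2 ^ Suc r - 1"
    by (subst card_atLeastLessThan, subst of_nat_diff) auto
  ultimately have "avg X {1..<2 ^ Suc r} h \<omega> = ((2 ^ r - 1) * u + 2 ^ r * v) / (2 ^ Suc r - 1)"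
    by (simp only: avg_def)
  also have "\<dots> = (1 - l) * u + l * v"
  proof -
    have d: "(2 ^ Suc r - 1 :: real) \<noteq> 0" using pos unfolding power_Suc by linarith
    then have l1: "(2::real) ^ r - 1 = (1 - l) * (2 ^ Suc r - 1)"
      and l2: "(2::real) ^ r = l * (2 ^ Suc r - 1)"
      by (simp_all add: l_def field_simps)
    have "(2 ^ r - 1) * u + 2 ^ r * v = (1 - l) * (2 ^ Suc r - 1) * u + l * (2 ^ Suc r - 1) * v"
      by (rule arg_cong2[where f="\<lambda>a b. a * u + b * v", OF l1 l2])
    also have "\<dots> = ((1 - l) * u + l * v) * (2 ^ Suc r - 1)"
      by (simp add: algebra_simps del: power_Suc)
    finally show ?thesis using d by (simp del: power_Suc)
  qed
  finally have "(avg X {1..<2 ^ Suc r} h \<omega>)\<^sup>2 = ((1 - l) * u + l * v)\<^sup>2"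
    by simp
  \<comment> \<open>The subtracted term is the exact gap in Jensen's inequality for the square; it
    is nonnegative and is dropped below.\<close>
  also have "\<dots> = (1 - l) * u\<^sup>2 + l * v\<^sup>2 - l * (1 - l) * (u - v)\<^sup>2"
    by (simp add: power2_eq_square algebra_simps)
  also have "\<dots> \<le> u\<^sup>2 / 2 + v\<^sup>2"
  proof -
    have "(0::real) < 2 * 2 ^ r - 1"
      using pos by linarith
    then have l: "1 / 2 \<le> l" "l \<le> 1"
      by (auto simp: l_def le_divide_eq divide_le_eq)
    have "(1 - l) * u\<^sup>2 \<le> 1 / 2 * u\<^sup>2" "l * v\<^sup>2 \<le> 1 * v\<^sup>2"
      by (rule mult_right_mono; use l in simp)+
    moreover have "0 \<le> l * (1 - l) * (u - v)\<^sup>2"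
      using l by simp
    ultimately show ?thesis by linarith
  qed
  finally show ?thesis by (simp only: u_def v_def)
qed

lemma tendsto_0_half_recursion:
  fixes a b :: "nat \<Rightarrow> real"
  assumes nonneg: "\<And>r. 0 \<le> b r" and step: "\<And>r. b (Suc r) \<le> b r / 2 + a r" and a: "a \<longlonglongrightarrow> 0"
  shows "b \<longlonglongrightarrow> 0"
proof (rule LIMSEQ_I)
  fix e :: real assume e: "0 < e"
  \<comment> \<open>The map x / 2 + e / 4 has fixed point e / 2, so beyond \<open>R\<close> the
    sequence exceeds \<open>e / 2\<close> by at most a geometrically decaying amount.\<close>
  have "eventually (\<lambda>r. a r < e / 4) sequentially"
    using a by (rule order_tendstoD) (use e in simp)
  then obtain R where R: "\<And>r. R \<le> r \<Longrightarrow> a r < e / 4"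
    by (auto simp: eventually_sequentially)
  have b_le: "b (R + k) \<le> b R * (1 / 2) ^ k + e / 2" for k
  proof (induction k)
    case 0
    show ?case using e by simp
  next
    case (Suc k)
    then show ?case using step[of "R + k"] R[of "R + k"] by simp
  qed
  have "(\<lambda>k. b R * (1 / 2) ^ k) \<longlonglongrightarrow> b R * 0"
    by (intro tendsto_intros LIMSEQ_realpow_zero) auto
  then have "eventually (\<lambda>k. b R * (1 / 2) ^ k < e / 2) sequentially"
    by (rule order_tendstoD) (use e in simp)
  then obtain k0 where k0: "\<And>k. k0 \<le> k \<Longrightarrow> b R * (1 / 2) ^ k < e / 2"
    by (auto simp: eventually_sequentially)
  show "\<exists>n0. \<forall>n\<ge>n0. norm (b n - 0) < e"
  proof (intro exI allI impI)
    fix n assume n: "R + k0 \<le> n"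
    then have "k0 \<le> n - R" by arith
    with n show "norm (b n - 0) < e"
      using b_le[of "n - R"] k0[of "n - R"] nonneg[of n] by simp
  qed
qed

section \<open>Permuted averages: measurability and second moments\<close>

lemma measurable_permuted:
  fixes X :: "nat \<Rightarrow> 'w \<Rightarrow> 'a::metric_space" and h :: "'a \<Rightarrow> real"
  assumes M: "prob_space M" and \<pi>: "uniform_generation_permutation M \<pi>" and indep: "indep_of_chain M \<pi> X"
    and X: "\<And>n. n \<in> tree \<Longrightarrow> X n \<in> M \<rightarrow>\<^sub>M borel" and h: "h \<in> borel_measurable borel"
    and i: "i \<in> tree"
  shows "(\<lambda>\<omega>. h (X (\<pi> \<omega> i) \<omega>)) \<in> borel_measurable M"
proof -
  interpret prob_space M by (rule M)
  let ?A = "vimage_algebra (space M) (\<lambda>\<omega>. \<lambda>n\<in>tree. \<pi> \<omega> n) (\<Pi>\<^sub>M n\<in>tree. count_space UNIV)"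
  \<comment> \<open>Measurability of \<open>\<pi>\<close> is extracted from independence, whose
    \<sigma>-fields consist of events of \<open>M\<close>.\<close>
  have "sets ?A \<subseteq> events"
    using indep unfolding indep_of_chain_def indep_sets2_eq by blast
  then have sub: "subalgebra M ?A"
    by (simp add: subalgebra_def)
  have "(\<lambda>\<omega>. \<pi> \<omega> i) \<in> ?A \<rightarrow>\<^sub>M count_space UNIV"
    using i by (rule measurable_vimage_algebra_component) auto
  then have "(\<lambda>\<omega>. \<pi> \<omega> i) \<in> M \<rightarrow>\<^sub>M count_space UNIV"
    by (rule measurable_from_subalg[OF sub])
  \<comment> \<open>The countable-index composition rule asks for measurability at every natural
    \<open>k\<close>; off the tree, where \<open>X k\<close> is arbitrary, the value 0 is
    substituted. The random index never leaves the tree.\<close>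
  moreover have "(\<lambda>\<omega>. if k \<in> tree then h (X k \<omega>) else 0) \<in> borel_measurable M" for k
    by (cases "k \<in> tree") (auto intro: measurable_compose[OF X h])
  ultimately have "(\<lambda>\<omega>. if \<pi> \<omega> i \<in> tree then h (X (\<pi> \<omega> i) \<omega>) else 0) \<in> borel_measurable M"
    by (rule measurable_compose_countable[rotated])
  moreover have "\<pi> \<omega> i \<in> tree" if "\<omega> \<in> space M" for \<omega>
    using \<pi> i that unfolding uniform_generation_permutation_def bij_betw_def by blast
  ultimately show ?thesis by (simp cong: measurable_cong)
qed

lemma measurable_avg_perm:
  fixes X :: "nat \<Rightarrow> 'w \<Rightarrow> 'a::metric_space" and h :: "'a \<Rightarrow> real"
  assumes M: "prob_space M" and \<pi>: "uniform_generation_permutation M \<pi>" and indep: "indep_of_chain M \<pi> X"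
    and X: "\<And>n. n \<in> tree \<Longrightarrow> X n \<in> M \<rightarrow>\<^sub>M borel" and h: "h \<in> borel_measurable borel"
  shows "avg_perm X \<pi> n h \<in> borel_measurable M"
  unfolding avg_perm_def[abs_def]
  by (intro borel_measurable_divide borel_measurable_sum measurable_permuted[OF assms])
    (auto simp: tree_def)

text \<open>Permuting complete generations does not change their total, so sampling affects only the
  incomplete generation \<open>r\<close>. The two contributions are separated by (a + b)^2 \<le> 2
  a^2 + 2 b^2, and both weights relative to \<open>n\<close> are at most 1.\<close>

lemma second_moment_avg_perm_le:
  fixes X :: "nat \<Rightarrow> 'w \<Rightarrow> 'a::metric_space"
  assumes M: "prob_space M" and \<pi>: "uniform_generation_permutation M \<pi>" and indep: "indep_of_chain M \<pi> X"
    and X: "\<And>n. n \<in> tree \<Longrightarrow> X n \<in> M \<rightarrow>\<^sub>M borel"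
    and h: "h \<in> borel_measurable borel" and C: "\<And>x. \<bar>h x\<bar> \<le> C"
    and n: "2 ^ r \<le> n" "n < 2 ^ Suc r"
  shows "(\<integral>\<omega>. (avg_perm X \<pi> n h \<omega>)\<^sup>2 \<partial>M)
    \<le> 2 * (\<integral>\<omega>. (avg X {1..<2 ^ r} h \<omega>)\<^sup>2 \<partial>M)
      + 2 * (C\<^sup>2 / real n + (\<integral>\<omega>. (avg X (generation r) h \<omega>)\<^sup>2 \<partial>M))"
proof -
  interpret prob_space M by (rule M)
  let ?I = "{2 ^ r..n}"
  define S where "S \<omega> = (\<Sum>i\<in>?I. h (X (\<pi> \<omega> i) \<omega>))" for \<omega>
  define b where "b = (\<integral>\<omega>. (avg X {1..<2 ^ r} h \<omega>)\<^sup>2 \<partial>M)"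
  define a where "a = (\<integral>\<omega>. (avg X (generation r) h \<omega>)\<^sup>2 \<partial>M)"
  have I: "?I \<subseteq> generation r"
    using n by (auto simp: generation_def)
  then have I_tree: "?I \<subseteq> tree"
    using generation_subset_tree[of r] by blast
  have pow: "(1::nat) \<le> 2 ^ r" by simp
  have n0: "0 < n" using n pow by linarith
  have pn: "2 ^ r \<le> real n" using n(1) of_nat_mono[of "2 ^ r" n, where ?'a=real] by simp
  have S_meas: "S \<in> borel_measurable M"
    unfolding S_def[abs_def] using measurable_permuted[OF M \<pi> indep X h] I_tree
    by (intro borel_measurable_sum) auto
  have S_le: "\<bar>S \<omega>\<bar> \<le> real (card ?I) * C" for \<omega>
    unfolding S_def by (rule order_trans[OF sum_abs sum_bounded_above]) (rule C)
  have int_S: "integrable M (\<lambda>\<omega>. (S \<omega>)\<^sup>2)"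
    by (rule integrable_const_bound[of _ "(real (card ?I) * C)\<^sup>2"])
       (use S_meas in \<open>auto simp del: card_atLeastAtMost simp: abs_le_square_iff[symmetric]
         intro: order_trans[OF S_le abs_ge_self]\<close>)
  have int_b: "integrable M (\<lambda>\<omega>. (avg X {1..<2 ^ r} h \<omega>)\<^sup>2)"
    by (rule integrable_avg_square[OF X h C]) (auto simp: tree_def)
  have a0: "0 \<le> a" unfolding a_def by (rule Bochner_Integration.integral_nonneg) simp
  have pointwise: "(avg_perm X \<pi> n h \<omega>)\<^sup>2 \<le> 2 * (avg X {1..<2 ^ r} h \<omega>)\<^sup>2 + 2 * ((S \<omega>)\<^sup>2 / (real n)\<^sup>2)"
    if \<omega>: "\<omega> \<in> space M" for \<omega>
  proof -
    define u where "u = avg X {1..<2 ^ r} h \<omega>"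
    have "(\<Sum>i\<in>{1..<2 ^ r}. h (X i \<omega>)) = (2 ^ r - 1) * u"
      unfolding u_def by (rule sum_initial_eq_avg)
    moreover have "{1..n} = {1..<2 ^ r} \<union> ?I"
      using n pow by auto
    then have "(\<Sum>i=1..n. h (X (\<pi> \<omega> i) \<omega>)) = (\<Sum>i\<in>{1..<2 ^ r}. h (X (\<pi> \<omega> i) \<omega>)) + S \<omega>"
      unfolding S_def by (simp only:) (subst sum.union_disjoint, auto)
    moreover have "(\<Sum>i\<in>{1..<2 ^ r}. h (X (\<pi> \<omega> i) \<omega>)) = (\<Sum>i\<in>{1..<2 ^ r}. h (X i \<omega>))"
      by (rule sum_permuted_initial[OF \<pi> \<omega>])
    ultimately have "avg_perm X \<pi> n h \<omega> = ((2 ^ r - 1) / real n) * u + S \<omega> / real n"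
      by (simp add: avg_perm_def add_divide_distrib)
    then have "(avg_perm X \<pi> n h \<omega>)\<^sup>2 \<le> 2 * (((2 ^ r - 1) / real n) * u)\<^sup>2 + 2 * (S \<omega> / real n)\<^sup>2"
      using sum_squares_bound[of "((2 ^ r - 1) / real n) * u" "S \<omega> / real n"]
      by (simp add: power2_sum)
    moreover have "(((2 ^ r - 1) / real n) * u)\<^sup>2 \<le> u\<^sup>2"
    proof -
      have "2 ^ r - 1 \<le> real n" using pn by linarith
      then have "((2 ^ r - 1) / real n)\<^sup>2 \<le> 1"
        using n0 by (intro power_le_one) auto
      from mult_right_mono[OF this zero_le_power2[of u]] show ?thesis
        by (simp only: power_mult_distrib mult_1)
    qed
    ultimately show ?thesis by (simp add: u_def power_divide)
  qed
  have "(\<integral>\<omega>. (avg_perm X \<pi> n h \<omega>)\<^sup>2 \<partial>M)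
      \<le> (\<integral>\<omega>. 2 * (avg X {1..<2 ^ r} h \<omega>)\<^sup>2 + 2 * ((S \<omega>)\<^sup>2 / (real n)\<^sup>2) \<partial>M)"
  proof (rule integral_mono_AE')
    show "integrable M (\<lambda>\<omega>. 2 * (avg X {1..<2 ^ r} h \<omega>)\<^sup>2 + 2 * ((S \<omega>)\<^sup>2 / (real n)\<^sup>2))"
      using int_S int_b by simp
    show "AE \<omega> in M. (avg_perm X \<pi> n h \<omega>)\<^sup>2
        \<le> 2 * (avg X {1..<2 ^ r} h \<omega>)\<^sup>2 + 2 * ((S \<omega>)\<^sup>2 / (real n)\<^sup>2)"
      using pointwise by (rule AE_I2)
  qed simp
  also have "\<dots> = 2 * b + 2 * ((\<integral>\<omega>. (S \<omega>)\<^sup>2 \<partial>M) / (real n)\<^sup>2)"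
    using int_S int_b by (simp add: b_def)
  also have "(\<integral>\<omega>. (S \<omega>)\<^sup>2 \<partial>M) \<le> real (card ?I) * C\<^sup>2 + (real (card ?I))\<^sup>2 * a"
    unfolding S_def a_def by (rule second_moment_permuted_le[OF M \<pi> indep X h C I])
  also have "\<dots> \<le> real n * C\<^sup>2 + (real n)\<^sup>2 * a"
  proof -
    have "card ?I \<le> n" unfolding card_atLeastAtMost using pow by linarith
    then have "real (card ?I) \<le> real n" by (rule of_nat_mono)
    then show ?thesis using a0 by (intro add_mono mult_right_mono power_mono) auto
  qed
  also have "(real n * C\<^sup>2 + (real n)\<^sup>2 * a) / (real n)\<^sup>2 = C\<^sup>2 / real n + a"
    using n0 by (simp add: field_simps power2_eq_square)
  finally show ?thesis
    by (simp add: a_def b_def divide_right_mono)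
qed

lemma second_moment_avg_perm_tendsto_0:
  fixes X :: "nat \<Rightarrow> 'w \<Rightarrow> 'a::metric_space"
  assumes M: "prob_space M" and \<pi>: "uniform_generation_permutation M \<pi>" and indep: "indep_of_chain M \<pi> X"
    and X: "\<And>n. n \<in> tree \<Longrightarrow> X n \<in> M \<rightarrow>\<^sub>M borel"
    and h: "h \<in> borel_measurable borel" and C: "\<And>x. \<bar>h x\<bar> \<le> C"
    and a: "(\<lambda>r. \<integral>\<omega>. (avg X (generation r) h \<omega>)\<^sup>2 \<partial>M) \<longlonglongrightarrow> 0"
    and b: "(\<lambda>r. \<integral>\<omega>. (avg X {1..<2 ^ r} h \<omega>)\<^sup>2 \<partial>M) \<longlonglongrightarrow> 0"
  shows "(\<lambda>n. \<integral>\<omega>. (avg_perm X \<pi> n h \<omega>)\<^sup>2 \<partial>M) \<longlonglongrightarrow> 0"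
proof (rule LIMSEQ_I)
  let ?a = "\<lambda>r. \<integral>\<omega>. (avg X (generation r) h \<omega>)\<^sup>2 \<partial>M"
  let ?b = "\<lambda>r. \<integral>\<omega>. (avg X {1..<2 ^ r} h \<omega>)\<^sup>2 \<partial>M"
  fix e :: real assume e: "0 < e"
  have "(\<lambda>r. 2 * ?b r + 2 * ?a r) \<longlonglongrightarrow> 2 * 0 + 2 * 0"
    by (intro tendsto_intros a b)
  then have "eventually (\<lambda>r. 2 * ?b r + 2 * ?a r < e / 2) sequentially"
    by (rule order_tendstoD) (use e in simp)
  then obtain R where R: "\<And>r. R \<le> r \<Longrightarrow> 2 * ?b r + 2 * ?a r < e / 2"
    by (auto simp: eventually_sequentially)
  have "(\<lambda>n. 2 * (C\<^sup>2 / real n)) \<longlonglongrightarrow> 2 * 0"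
    by (intro tendsto_intros lim_const_over_n)
  then have "eventually (\<lambda>n. 2 * (C\<^sup>2 / real n) < e / 2) sequentially"
    by (rule order_tendstoD) (use e in simp)
  then obtain n0 where n0: "\<And>n. n0 \<le> n \<Longrightarrow> 2 * (C\<^sup>2 / real n) < e / 2"
    by (auto simp: eventually_sequentially)
  show "\<exists>N. \<forall>n\<ge>N. norm ((\<integral>\<omega>. (avg_perm X \<pi> n h \<omega>)\<^sup>2 \<partial>M) - 0) < e"
  proof (intro exI allI impI)
    fix n assume n: "max n0 (2 ^ R) \<le> n"
    have "(1::nat) \<le> 2 ^ R" by simp
    with n have "1 \<le> n" by linarith
    then obtain r where r: "2 ^ r \<le> n" "n < 2 ^ Suc r"
      using ex_power_ivl1[of 2 n] by auto
    \<comment> \<open>Taking \<open>n\<close> at least \<open>2 ^ R\<close> forces its generation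
      \<open>r\<close> to be at least \<open>R\<close>, where the bound on both second moments
      holds.\<close>
    have "(2::nat) ^ R < 2 ^ Suc r" using n r(2) by linarith
    then have "R < Suc r" by (rule power_less_imp_less_exp[rotated]) simp
    then have "2 * ?b r + 2 * ?a r < e / 2" by (intro R) simp
    moreover have "2 * (C\<^sup>2 / real n) < e / 2" using n by (intro n0) simp
    moreover have "0 \<le> (\<integral>\<omega>. (avg_perm X \<pi> n h \<omega>)\<^sup>2 \<partial>M)"
      by (rule Bochner_Integration.integral_nonneg) simp
    ultimately show "norm ((\<integral>\<omega>. (avg_perm X \<pi> n h \<omega>)\<^sup>2 \<partial>M) - 0) < e"
      using second_moment_avg_perm_le[OF M \<pi> indep X h C r] by (simp add: distrib_left)
  qed
qed

section \<open>Square integrability and centering\<close>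

lemma (in prob_space) bounded_in_L2:
  assumes "Z \<in> borel_measurable M" "\<And>\<omega>. \<bar>Z \<omega>\<bar> \<le> C"
  shows "Z \<in> L2 M"
proof -
  have "integrable M (\<lambda>\<omega>. (Z \<omega>)\<^sup>2)"
    by (rule integrable_const_bound[of _ "C\<^sup>2"])
       (use assms in \<open>auto simp: abs_le_square_iff[symmetric]
         intro: order_trans[OF assms(2) abs_ge_self]\<close>)
  then show ?thesis using assms by (simp add: L2_def)
qed

lemma avg_diff_const:
  assumes "finite I" "I \<noteq> {}"
  shows "avg X I (\<lambda>x. f x - c) \<omega> = avg X I f \<omega> - c"
  using assms by (simp add: avg_def sum_subtractf diff_divide_distrib)

lemma avg_perm_diff_const:
  assumes "0 < n"
  shows "avg_perm X \<pi> n (\<lambda>x. f x - c) \<omega> = avg_perm X \<pi> n f \<omega> - c"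
  using assms by (simp add: avg_perm_def sum_subtractf diff_divide_distrib)

section \<open>Convergence\<close>

theorem theorem8:
  fixes M :: "'w measure" and F :: "nat \<Rightarrow> 'w measure"
    and X :: "nat \<Rightarrow> 'w \<Rightarrow> 'a::metric_space"
    and \<nu> \<mu> :: "'a measure" and P :: "'a \<Rightarrow> ('a \<times> 'a) measure"
    and \<pi> :: "'w \<Rightarrow> nat \<Rightarrow> nat" and f :: "'a \<Rightarrow> real"
  assumes "bifurcating_markov_chain M F X \<nu> P"
    and "uniform_generation_permutation M \<pi>"
    and "indep_of_chain M \<pi> X"
    and "induced_chain_ergodic P \<mu>"
    and "continuous_on UNIV f" and "bounded (range f)"
  shows "tendsto_L2 M (\<lambda>q. avg X (generation q) f) (\<lambda>_. \<integral>x. f x \<partial>\<mu>) \<and>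
    tendsto_L2 M (\<lambda>r. avg X (subtree r) f) (\<lambda>_. \<integral>x. f x \<partial>\<mu>) \<and>
    tendsto_L2 M (\<lambda>n. avg_perm X \<pi> n f) (\<lambda>_. \<integral>x. f x \<partial>\<mu>)"
proof -
  note X = assms(1) and \<pi> = assms(2) and indep = assms(3)
  have M: "prob_space M" and P: "T_transition P"
    using X by (auto simp: bifurcating_markov_chain_def)
  interpret prob_space M by (rule M)
  define c where "c = (\<integral>x. f x \<partial>\<mu>)"
  define h where "h x = f x - c" for x
  obtain B where B: "\<And>x. \<bar>f x\<bar> \<le> B"
    using assms(6) by (auto simp: bounded_iff)
  have f: "f \<in> borel_measurable borel"
    using assms(5) by (rule borel_measurable_continuous_onI)
  then have h: "h \<in> borel_measurable borel"
    unfolding h_def[abs_def] by measurable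
  have C: "\<bar>h x\<bar> \<le> B + \<bar>c\<bar>" for x
    using B[of x] by (simp add: h_def)
  have X_meas: "X n \<in> M \<rightarrow>\<^sub>M borel" if "n \<in> tree" for n
    using measurable_bifurcating_markov_chain[OF X that] .
  have tree: "generation q \<subseteq> tree" "{1..<2 ^ q} \<subseteq> tree" "subtree q \<subseteq> tree" for q
    using generation_subset_tree by (auto simp: tree_def subtree_eq)
  have nonempty: "generation q \<noteq> {}" "subtree q \<noteq> {}" "finite (subtree q)" for q
    using one_less_power[of "2::nat" "Suc q"]
    by (auto simp: generation_def subtree_eq simp del: power_Suc)
  have lim: "(\<lambda>k. \<integral>y. h y \<partial>induced_law P k x) \<longlonglongrightarrow> 0" for x
  proof -
    \<comment> \<open>The iterated laws have mass 1, so subtracting \<open>c\<close> from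
      \<open>f\<close> subtracts it from every integral; ergodicity of \<open>f\<close> then gives
      limit 0 for \<open>h\<close>.\<close>
    have "(\<integral>y. h y \<partial>induced_law P k x) = (\<integral>y. f y \<partial>induced_law P k x) - c" for k
    proof -
      have *: "sets (induced_law P k x) = sets borel" "prob_space (induced_law P k x)"
        using induced_law_prob_algebra[OF P, of k x] by (auto simp: space_prob_algebra)
      interpret law: prob_space "induced_law P k x" by (rule *(2))
      have "integrable (induced_law P k x) f"
        by (rule law.integrable_const_bound[of _ B]) (use B f * in \<open>auto cong: measurable_cong_sets\<close>)
      then show ?thesis unfolding h_def by (simp add: law.prob_space)
    qed
    moreover have "(\<lambda>k. \<integral>y. f y \<partial>induced_law P k x) \<longlonglongrightarrow> c"
      using assms(4-6) by (auto simp: induced_chain_ergodic_def c_def)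
    ultimately show ?thesis by (simp add: LIM_zero)
  qed
  have a: "(\<lambda>q. \<integral>\<omega>. (avg X (generation q) h \<omega>)\<^sup>2 \<partial>M) \<longlonglongrightarrow> 0"
    by (rule second_moment_generation_tendsto_0[OF X h C lim])
  \<comment> \<open>Integrating the convexity estimate gives a halving recursion whose forcing term
    is the second moment over generation \<open>r\<close>.\<close>
  have b: "(\<lambda>r. \<integral>\<omega>. (avg X {1..<2 ^ r} h \<omega>)\<^sup>2 \<partial>M) \<longlonglongrightarrow> 0"
  proof (rule tendsto_0_half_recursion[OF _ _ a])
    fix r
    have int: "integrable M (\<lambda>\<omega>. (avg X I h \<omega>)\<^sup>2)" if "I \<subseteq> tree" for I
      using that by (intro integrable_avg_square[OF X_meas h C]) auto
    have "(\<integral>\<omega>. (avg X {1..<2 ^ Suc r} h \<omega>)\<^sup>2 \<partial>M)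
        \<le> (\<integral>\<omega>. (avg X {1..<2 ^ r} h \<omega>)\<^sup>2 / 2 + (avg X (generation r) h \<omega>)\<^sup>2 \<partial>M)"
      by (intro integral_mono avg_initial_Suc_square_le Bochner_Integration.integrable_add
          integrable_divide int tree)
    then show "(\<integral>\<omega>. (avg X {1..<2 ^ Suc r} h \<omega>)\<^sup>2 \<partial>M)
        \<le> (\<integral>\<omega>. (avg X {1..<2 ^ r} h \<omega>)\<^sup>2 \<partial>M) / 2 + (\<integral>\<omega>. (avg X (generation r) h \<omega>)\<^sup>2 \<partial>M)"
      using int[OF tree(1)] int[OF tree(2)] by simp
  qed (auto intro: Bochner_Integration.integral_nonneg)
  have p: "(\<lambda>n. \<integral>\<omega>. (avg_perm X \<pi> n h \<omega>)\<^sup>2 \<partial>M) \<longlonglongrightarrow> 0"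
    by (rule second_moment_avg_perm_tendsto_0[OF M \<pi> indep X_meas h C a b])
  have const: "(\<lambda>_. c) \<in> L2 M"
    by (rule bounded_in_L2[of _ "\<bar>c\<bar>"]) auto
  have avg_L2: "avg X I f \<in> L2 M" if "I \<subseteq> tree" for I
    using that by (intro bounded_in_L2[of _ B] measurable_avg X_meas f abs_avg_le B) auto
  have perm_L2: "avg_perm X \<pi> n f \<in> L2 M" for n
  proof (rule bounded_in_L2[of _ B])
    show "\<bar>avg_perm X \<pi> n f \<omega>\<bar> \<le> B" for \<omega>
      \<comment> \<open>For each \<omega> the permuted average is an ordinary average of the family
        relabelled by \<open>\<pi>\<close>, so the same bound applies, including at
        \<open>n = 0\<close>.\<close>
      using abs_avg_le[of f B "\<lambda>i \<omega>. X (\<pi> \<omega> i) \<omega>" "{1..n}" \<omega>] B by (simp add: avg_def avg_perm_def)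
  qed (rule measurable_avg_perm[OF M \<pi> indep X_meas f])
  have "tendsto_L2 M (\<lambda>q. avg X (generation q) f) (\<lambda>_. c)"
    using a avg_L2[OF tree(1)] const by (simp add: tendsto_L2_def h_def[abs_def] avg_diff_const nonempty)
  moreover have "tendsto_L2 M (\<lambda>r. avg X (subtree r) f) (\<lambda>_. c)"
  proof -
    have "(\<lambda>r. \<integral>\<omega>. (avg X (subtree r) h \<omega>)\<^sup>2 \<partial>M) \<longlonglongrightarrow> 0"
      \<comment> \<open>\<open>subtree r\<close> is the segment below \<open>2 ^ Suc r\<close>,
        whence the shift of the sequence by one.\<close>
      unfolding subtree_eq using b by (rule LIMSEQ_Suc)
    then show ?thesis
      using avg_L2[OF tree(3)] const by (simp add: tendsto_L2_def h_def[abs_def] avg_diff_const nonempty)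
  qed
  moreover have "tendsto_L2 M (\<lambda>n. avg_perm X \<pi> n f) (\<lambda>_. c)"
  proof -
    \<comment> \<open>Centering commutes with the average only for \<open>n > 0\<close>: at
      \<open>n = 0\<close> the averages of \<open>h\<close> and \<open>f\<close> are both 0, so the
      two sides differ unless \<open>c = 0\<close>.\<close>
    have "eventually (\<lambda>n. (\<integral>\<omega>. (avg_perm X \<pi> n h \<omega>)\<^sup>2 \<partial>M)
        = (\<integral>\<omega>. (avg_perm X \<pi> n f \<omega> - c)\<^sup>2 \<partial>M)) sequentially"
      using eventually_gt_at_top[of 0]
      by eventually_elim (simp add: h_def[abs_def] avg_perm_diff_const)
    then have "(\<lambda>n. \<integral>\<omega>. (avg_perm X \<pi> n f \<omega> - c)\<^sup>2 \<partial>M) \<longlonglongrightarrow> 0"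
      using p by (rule tendsto_cong[THEN iffD1])
    then show ?thesis using perm_L2 const by (simp add: tendsto_L2_def)
  qed
  ultimately show ?thesis by (simp add: c_def)
qed

end
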